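(* Let $G$ be a countable locally nilpotent group (every finitely generated subgroup of $G$ is nilpotent) acting freely and continuously on a zero-dimensional Polish space $X$. Then the orbit equivalence relation $E^X_G=\{(x,y): \exists g\in G,\ g\cdot x=y\}$ is continuously embeddable into $E_0$, i.e. there is a continuous injective map $f:X\to 2^{\mathbb{N}}$ such that for all $x,y\in X$, $x\mathrel{E^X_G}y \iff f(x)\mathrel{E_0}f(y)$.
   Context: $E_0$ is the equivalence relation on $2^{\mathbb{N}}$ given by $x\mathrel{E_0}y$ iff there is $n$ with $x(k)=y(k)$ for all $k\ge n$. The action is free if $g\cdot x\neq x$ for all $x\in X$ and all $g\neq 1_G$. $G$ is a discrete group and continuity of the action means each map $x\mapsto g\cdot x$ is continuous. *)

theory Defs
  imports "HOL-Analysis.Analysis" "HOL-Algebra.Group_Action" "HOL-Algebra.Generated_Groups"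
begin

definition Polish_space :: "'a topology \<Rightarrow> bool" where
  "Polish_space X \<longleftrightarrow> completely_metrizable_space X \<and> separable_space X"

text \<open>Zero-dimensional: small inductive dimension at most 0 (clopen neighbourhood base).\<close>
definition zero_dimensional :: "'a topology \<Rightarrow> bool" where
  "zero_dimensional X \<longleftrightarrow> X dim_le 0"

definition commutator_set :: "('a, 'b) monoid_scheme \<Rightarrow> 'a set \<Rightarrow> 'a set \<Rightarrow> 'a set" where
  "commutator_set G A B =
     (\<Union>a\<in>A. \<Union>b\<in>B. {a \<otimes>\<^bsub>G\<^esub> b \<otimes>\<^bsub>G\<^esub> inv\<^bsub>G\<^esub> a \<otimes>\<^bsub>G\<^esub> inv\<^bsub>G\<^esub> b})"

fun lower_central :: "('a, 'b) monoid_scheme \<Rightarrow> nat \<Rightarrow> 'a set" where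
  "lower_central G 0 = carrier G"
| "lower_central G (Suc n) = generate G (commutator_set G (carrier G) (lower_central G n))"

definition nilpotent_group :: "('a, 'b) monoid_scheme \<Rightarrow> bool" where
  "nilpotent_group G \<longleftrightarrow> group G \<and> (\<exists>n. lower_central G n = {\<one>\<^bsub>G\<^esub>})"

definition locally_nilpotent_group :: "('a, 'b) monoid_scheme \<Rightarrow> bool" where
  "locally_nilpotent_group G \<longleftrightarrow> group G \<and>
     (\<forall>S. S \<subseteq> carrier G \<and> finite S \<longrightarrow> nilpotent_group (subgroup_generated G S))"

definition cantor_space :: "(nat \<Rightarrow> bool) topology" where
  "cantor_space = product_topology (\<lambda>_. discrete_topology (UNIV :: bool set)) UNIV"

definition E0 :: "(nat \<Rightarrow> bool) \<Rightarrow> (nat \<Rightarrow> bool) \<Rightarrow> bool" where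
  "E0 x y \<longleftrightarrow> (\<exists>n. \<forall>k\<ge>n. x k = y k)"

end

theory Submission
  imports Defs
begin

text \<open>Exhaust \<open>G\<close> by the subgroups generated by finite symmetric sets \<open>S\<^sub>0 \<subseteq> S\<^sub>1 \<subseteq> \<dots>\<close>; each has
  polynomial growth, hence is doubling at arbitrarily large scales with a constant \<open>K\<^sub>i\<close>
  independent of the scale. It suffices to find maps \<open>P\<^sub>n : X \<rightarrow> X\<close>, each moving points by finitely
  many group elements chosen in a locally constant way, such that \<open>P\<^sub>n (g x) = P\<^sub>n x\<close> for all but
  finitely many \<open>n\<close>: one codes \<open>x\<close> by the group elements carrying \<open>P\<^sub>n x\<close> to \<open>P\<^sub>n\<^sub>+\<^sub>1 x\<close>, together
  with the position of finitely many translates of \<open>P\<^sub>n x\<close> in a clopen base. Starting from the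
  identity, \<open>P\<^sub>n\<close> is rounded at the levels \<open>n, n - 1, \<dots>, 0\<close>; the rounding at level \<open>i\<close> uses cells of
  the \<open>S\<^sub>i\<close>-metric and ensures that at most \<open>K\<^sub>i\<close> of the maps \<open>P\<^sub>n\<close>, \<open>n \<ge> i\<close>, vary near any given
  point. The bound \<open>K\<^sub>i\<close> does not depend on \<open>K\<^sub>i\<^sub>+\<^sub>1\<close>, which is what makes the descent possible.\<close>

section \<open>Polynomial growth of nilpotent groups\<close>

primrec set_pow :: "('a, 'b) monoid_scheme \<Rightarrow> 'a set \<Rightarrow> nat \<Rightarrow> 'a set" where
  "set_pow G S 0 = {\<one>\<^bsub>G\<^esub>}"
| "set_pow G S (Suc n) = set_pow G S n <#>\<^bsub>G\<^esub> S"

text \<open>The identity is included so that \<open>set_pow G (symmetrize G T) n\<close> is the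
  whole ball of radius \<open>n\<close> in the word metric of \<open>T\<close>, not only the
  products of exactly \<open>n\<close> nontrivial letters.\<close>

definition symmetrize :: "('a, 'b) monoid_scheme \<Rightarrow> 'a set \<Rightarrow> 'a set" where
  "symmetrize G T = insert \<one>\<^bsub>G\<^esub> (T \<union> m_inv G ` T)"

definition poly_growth :: "('a, 'b) monoid_scheme \<Rightarrow> 'a set \<Rightarrow> bool" where
  "poly_growth G T \<longleftrightarrow> (\<exists>C D. \<forall>n. card (set_pow G (symmetrize G T) n) \<le> C * Suc n ^ D)"

lemma set_mult_memI: "a \<in> A \<Longrightarrow> b \<in> B \<Longrightarrow> a \<otimes>\<^bsub>G\<^esub> b \<in> A <#>\<^bsub>G\<^esub> B"
  by (auto simp: set_mult_def)

lemma set_mult_memE: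
  assumes "x \<in> A <#>\<^bsub>G\<^esub> B"
  obtains a b where "a \<in> A" "b \<in> B" "x = a \<otimes>\<^bsub>G\<^esub> b"
  using assms by (auto simp: set_mult_def)

lemma finite_set_mult: "finite A \<Longrightarrow> finite B \<Longrightarrow> finite (A <#>\<^bsub>G\<^esub> B)"
  by (auto simp: set_mult_def)

lemma finite_set_pow: "finite S \<Longrightarrow> finite (set_pow G S n)"
  by (induction n) (auto simp: finite_set_mult)

lemma finite_symmetrize: "finite T \<Longrightarrow> finite (symmetrize G T)"
  by (simp add: symmetrize_def)

lemma set_pow_mono: "S \<subseteq> T \<Longrightarrow> set_pow G S n \<subseteq> set_pow G T n"
  by (induction n) (auto intro: mono_set_mult[THEN subsetD])

lemma symmetrize_mono: "S \<subseteq> T \<Longrightarrow> symmetrize G S \<subseteq> symmetrize G T"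
  by (auto simp: symmetrize_def)

lemma poly_growth_mono:
  assumes "poly_growth G T" "S \<subseteq> T" "finite T"
  shows "poly_growth G S"
proof -
  have "card (set_pow G (symmetrize G S) n) \<le> card (set_pow G (symmetrize G T) n)" for n
    using assms by (intro card_mono set_pow_mono symmetrize_mono finite_set_pow finite_symmetrize)
  then show ?thesis
    using assms(1) unfolding poly_growth_def by (meson le_trans)
qed

context group
begin

lemma symmetrize_closed: "T \<subseteq> carrier G \<Longrightarrow> symmetrize G T \<subseteq> carrier G"
  by (auto simp: symmetrize_def)

lemma symmetrize_inv: "T \<subseteq> carrier G \<Longrightarrow> x \<in> symmetrize G T \<Longrightarrow> inv x \<in> symmetrize G T"
  by (auto simp: symmetrize_def)

lemma set_pow_closed: "S \<subseteq> carrier G \<Longrightarrow> set_pow G S n \<subseteq> carrier G"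
  by (induction n) (auto simp: set_mult_closed)

lemma set_pow_add:
  assumes "S \<subseteq> carrier G"
  shows "set_pow G S (m + n) = set_pow G S m <#> set_pow G S n"
proof (induction n)
  case 0
  then show ?case
    using set_pow_closed[OF assms, of m] by (force simp: set_mult_def subset_eq)
next
  case (Suc n)
  then show ?case
    using set_pow_closed[OF assms] assms by (simp add: set_mult_assoc)
qed

lemma set_pow_mult_mem:
  "S \<subseteq> carrier G \<Longrightarrow> x \<in> set_pow G S m \<Longrightarrow> y \<in> set_pow G S n \<Longrightarrow> x \<otimes> y \<in> set_pow G S (m + n)"
  by (simp add: set_pow_add set_mult_memI)

lemma one_in_set_pow: "\<one> \<in> S \<Longrightarrow> \<one> \<in> set_pow G S n"
  by (induction n) (auto simp: set_mult_def intro!: bexI[of _ \<one>])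

lemma set_pow_le:
  assumes "S \<subseteq> carrier G" "\<one> \<in> S" "m \<le> n"
  shows "set_pow G S m \<subseteq> set_pow G S n"
proof
  fix x assume x: "x \<in> set_pow G S m"
  then have "x \<in> carrier G" using set_pow_closed assms by blast
  then show "x \<in> set_pow G S n"
    using set_pow_mult_mem[OF assms(1) x one_in_set_pow[OF assms(2), of "n - m"]] assms(3) by simp
qed

lemma set_pow_1: "S \<subseteq> carrier G \<Longrightarrow> set_pow G S 1 = S"
  by (force simp: set_mult_def subset_eq)

lemma set_pow_inv:
  assumes "S \<subseteq> carrier G" "\<And>s. s \<in> S \<Longrightarrow> inv s \<in> S" "x \<in> set_pow G S n"
  shows "inv x \<in> set_pow G S n"
  using assms(3)
proof (induction n arbitrary: x)
  case (Suc n)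
  then obtain a s where "a \<in> set_pow G S n" "s \<in> S" and x: "x = a \<otimes> s"
    by (auto elim: set_mult_memE)
  moreover from this have "inv x = inv s \<otimes> inv a"
    using set_pow_closed[OF assms(1)] assms(1) by (metis inv_mult_group subsetD)
  moreover have "inv s \<in> set_pow G S 1"
    using assms \<open>s \<in> S\<close> by (simp only: set_pow_1)
  ultimately show ?case
    using Suc.IH set_pow_mult_mem[OF assms(1), of "inv s" 1 "inv a" n] by simp
qed simp

section \<open>Lower central series and collection of words\<close>

lemma lower_central_closed: "lower_central G n \<subseteq> carrier G"
proof (induction n)
  case (Suc n)
  have "commutator_set G (carrier G) (lower_central G n) \<subseteq> carrier G"
    using Suc by (auto simp: commutator_set_def)
  then show ?case
    by (simp add: generate_incl)
qed simp

lemma commutator_in_lower_central: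
  "a \<in> carrier G \<Longrightarrow> b \<in> lower_central G n \<Longrightarrow> a \<otimes> b \<otimes> inv a \<otimes> inv b \<in> lower_central G (Suc n)"
  by (auto simp: commutator_set_def intro!: generate.incl)

lemma lower_central_Suc_subset: "lower_central G (Suc n) \<subseteq> lower_central G n"
proof (induction n)
  case 0
  show ?case using lower_central_closed[of "Suc 0"] by simp
next
  case (Suc n)
  have "commutator_set G (carrier G) (lower_central G (Suc n))
        \<subseteq> commutator_set G (carrier G) (lower_central G n)"
    using Suc by (fastforce simp: commutator_set_def)
  then show ?case
    using mono_generate by (metis lower_central.simps(2))
qed

lemma conj_mult:
  assumes "u \<in> carrier G" "a \<in> carrier G" "b \<in> carrier G"
  shows "u \<otimes> (a \<otimes> b) \<otimes> inv u = (u \<otimes> a \<otimes> inv u) \<otimes> (u \<otimes> b \<otimes> inv u)"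
proof -
  have "inv u \<otimes> (u \<otimes> (b \<otimes> inv u)) = b \<otimes> inv u"
    using assms by (simp flip: m_assoc)
  then show ?thesis
    using assms by (simp add: m_assoc)
qed

text \<open>Writing \<open>u a u\<^sup>-\<^sup>1 = [u, a] a\<close>, the length of the \<open>k\<close>-fold conjugate
  obeys Pascal's recursion, and iterated commutators vanish after \<open>c\<close> steps.\<close>

lemma conj_pow_length:
  fixes c N :: nat
  assumes c: "lower_central G c = {\<one>}"
    and T: "T \<subseteq> carrier G" and u: "u \<in> carrier G"
    and comm: "\<And>a. a \<in> T \<Longrightarrow> u \<otimes> a \<otimes> inv u \<otimes> inv a \<in> T"
    and "v \<le> c" "a \<in> T" "a \<in> lower_central G (c - v)" "k \<le> N"
  shows "u [^] k \<otimes> a \<otimes> inv (u [^] k) \<in> set_pow G (symmetrize G T) (Suc N ^ v)"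
  using assms(5-)
proof (induction v arbitrary: a k)
  case 0
  then have "u [^] k \<otimes> a \<otimes> inv (u [^] k) = \<one>"
    using u c by simp
  then show ?case
    by (simp only:) (rule one_in_set_pow, simp add: symmetrize_def)
next
  case (Suc v)
  note Y = symmetrize_closed[OF T] and IH = Suc.IH
  \<comment> \<open>The inner induction needs a bound linear in \<open>k\<close>: each further
    conjugation contributes one conjugated commutator, which lies one step deeper in the series and
    so has length at most \<open>Suc N ^ v\<close>.\<close>
  have "u [^] k \<otimes> a \<otimes> inv (u [^] k) \<in> set_pow G (symmetrize G T) (1 + k * Suc N ^ v)"
    if "k \<le> N" for k using that
  proof (induction k)
    case 0
    have "a \<in> carrier G" using Suc.prems T by auto
    then show ?case
      using Suc.prems set_pow_1[OF Y] by (simp add: symmetrize_def)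
  next
    case (Suc k)
    let ?b = "u \<otimes> a \<otimes> inv u \<otimes> inv a"
    have a: "a \<in> T" "a \<in> carrier G" using Suc.prems \<open>a \<in> T\<close> T by auto
    have b: "?b \<in> T" "?b \<in> carrier G" using comm a T by auto
    have "?b \<in> lower_central G (Suc (c - Suc v))"
      using commutator_in_lower_central[OF u \<open>a \<in> lower_central G (c - Suc v)\<close>] .
    moreover have "Suc (c - Suc v) = c - v" using \<open>Suc v \<le> c\<close> by simp
    ultimately have "?b \<in> lower_central G (c - v)" by (simp only:)
    then have 1: "u [^] k \<otimes> ?b \<otimes> inv (u [^] k) \<in> set_pow G (symmetrize G T) (Suc N ^ v)"
      using Suc.prems \<open>Suc v \<le> c\<close> b by (intro IH) auto
    have 2: "u [^] k \<otimes> a \<otimes> inv (u [^] k) \<in> set_pow G (symmetrize G T) (1 + k * Suc N ^ v)"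
      using Suc by simp
    have "u [^] Suc k \<otimes> a \<otimes> inv (u [^] Suc k) = u [^] k \<otimes> (u \<otimes> a \<otimes> inv u) \<otimes> inv (u [^] k)"
      using u a by (simp add: inv_mult_group m_assoc)
    also have "u \<otimes> a \<otimes> inv u = ?b \<otimes> a"
      using u a by (simp add: m_assoc)
    also have "u [^] k \<otimes> (?b \<otimes> a) \<otimes> inv (u [^] k)
        = (u [^] k \<otimes> ?b \<otimes> inv (u [^] k)) \<otimes> (u [^] k \<otimes> a \<otimes> inv (u [^] k))"
      using u a b by (intro conj_mult) auto
    also have "\<dots> \<in> set_pow G (symmetrize G T) (Suc N ^ v + (1 + k * Suc N ^ v))"
      by (rule set_pow_mult_mem[OF Y 1 2])
    finally show ?case by (simp add: algebra_simps)
  qed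
  from this[OF \<open>k \<le> N\<close>] show ?case
  proof (rule set_pow_le[THEN subsetD, rotated -1])
    have "1 + k * Suc N ^ v \<le> Suc N ^ v + N * Suc N ^ v"
      using \<open>k \<le> N\<close> by (intro add_mono mult_mono) auto
    then show "1 + k * Suc N ^ v \<le> Suc N ^ Suc v" by simp
  qed (use Y in \<open>auto simp: symmetrize_def\<close>)
qed

text \<open>Negative powers of \<open>t\<close> are positive powers of \<open>inv t\<close>, so
  \<open>conj_pow_length\<close> applies through the second commutator hypothesis; inverse letters
  are treated by inverting the whole conjugate. The depth is \<open>v = c\<close> because
  \<open>lower_central G 0\<close> is the whole carrier.\<close>

lemma conj_int_pow_length:
  fixes c N :: nat and k :: int
  assumes c: "lower_central G c = {\<one>}"
    and T: "T \<subseteq> carrier G" and t: "t \<in> carrier G"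
    and comm: "\<And>a. a \<in> T \<Longrightarrow> t \<otimes> a \<otimes> inv t \<otimes> inv a \<in> T"
      "\<And>a. a \<in> T \<Longrightarrow> inv t \<otimes> a \<otimes> t \<otimes> inv a \<in> T"
    and y: "y \<in> symmetrize G T" and k: "\<bar>k\<bar> \<le> int N"
  shows "t [^] k \<otimes> y \<otimes> inv (t [^] k) \<in> set_pow G (symmetrize G T) (Suc N ^ c)"
proof -
  note Y = symmetrize_closed[OF T]
  have T': "t [^] k \<otimes> a \<otimes> inv (t [^] k) \<in> set_pow G (symmetrize G T) (Suc N ^ c)" if "a \<in> T" for a
  proof -
    have a: "a \<in> lower_central G (c - c)" using that T by auto
    have N: "nat k \<le> N" "nat (-k) \<le> N" using k by linarith+
    show ?thesis
    proof (cases "k \<ge> 0")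
      case True
      have "t [^] nat k \<otimes> a \<otimes> inv (t [^] nat k) \<in> set_pow G (symmetrize G T) (Suc N ^ c)"
        using c T t comm(1) order_refl that a N(1) by (rule conj_pow_length)
      then show ?thesis using True by simp
    next
      case False
      have "inv t [^] nat (-k) \<otimes> a \<otimes> inv (inv t [^] nat (-k)) \<in> set_pow G (symmetrize G T) (Suc N ^ c)"
      proof (rule conj_pow_length[where v = c])
        show "inv t \<otimes> b \<otimes> inv (inv t) \<otimes> inv b \<in> T" if "b \<in> T" for b
          using comm(2)[OF that] t by simp
      qed (use c T t that a N in auto)
      moreover have "t [^] k = inv t [^] nat (-k)"
        using False t by (subst int_pow_def2) (simp add: nat_pow_inv del: pow_nat)
      ultimately show ?thesis by (simp only:)
    qed
  qed
  from y consider "y = \<one>" | "y \<in> T" | a where "a \<in> T" "y = inv a"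
    by (auto simp: symmetrize_def)
  then show ?thesis
  proof cases
    case 1
    then show ?thesis using t by (auto intro!: one_in_set_pow simp: symmetrize_def)
  next
    case 2
    then show ?thesis by (rule T')
  next
    case 3
    then have "a \<in> carrier G" using T by auto
    then have "t [^] k \<otimes> y \<otimes> inv (t [^] k) = inv (t [^] k \<otimes> a \<otimes> inv (t [^] k))"
      using t 3 by (simp add: inv_mult_group m_assoc)
    then show ?thesis
      using set_pow_inv[OF Y symmetrize_inv[OF T] T'[OF \<open>a \<in> T\<close>]] by simp
  qed
qed

text \<open>This is a collection process moving every \<open>t\<close> to the right end of the word.
  A letter of \<open>T\<close> that crosses a power of \<open>t\<close> with exponent at most
  \<open>N\<close> in absolute value becomes a word of length at most
  \<open>Suc N ^ c\<close>.\<close>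

lemma set_pow_insert_subset:
  assumes c: "lower_central G c = {\<one>}"
    and T: "T \<subseteq> carrier G" and t: "t \<in> carrier G"
    and comm: "\<And>a. a \<in> T \<Longrightarrow> t \<otimes> a \<otimes> inv t \<otimes> inv a \<in> T"
      "\<And>a. a \<in> T \<Longrightarrow> inv t \<otimes> a \<otimes> t \<otimes> inv a \<in> T"
    and "n \<le> N"
  shows "set_pow G (symmetrize G (insert t T)) n
         \<subseteq> set_pow G (symmetrize G T) (n * Suc N ^ c) <#> (\<lambda>k::int. t [^] k) ` {-int n..int n}"
  using \<open>n \<le> N\<close>
proof (induction n)
  case 0
  then show ?case by (auto simp: set_mult_def)
next
  case (Suc n)
  note Y = symmetrize_closed[OF T]
  let ?P = "set_pow G (symmetrize G T)"
  show ?case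
  proof
    fix x assume "x \<in> set_pow G (symmetrize G (insert t T)) (Suc n)"
    then obtain z s where z: "z \<in> set_pow G (symmetrize G (insert t T)) n"
      and s: "s \<in> symmetrize G (insert t T)" and x: "x = z \<otimes> s"
      by (auto elim: set_mult_memE)
    then obtain y k where y: "y \<in> ?P (n * Suc N ^ c)" and k: "\<bar>k\<bar> \<le> int n" and zy: "z = y \<otimes> t [^] (k::int)"
    proof -
      have "z \<in> ?P (n * Suc N ^ c) <#> (\<lambda>k::int. t [^] k) ` {-int n..int n}"
        using Suc z by auto
      then show ?thesis
        by (elim set_mult_memE imageE) (rule that, auto)
    qed
    have yG: "y \<in> carrier G" using y set_pow_closed[OF Y] by auto
    have "\<exists>s' k'. s' \<in> ?P (Suc N ^ c) \<and> \<bar>k'\<bar> \<le> int (Suc n) \<and> t [^] k \<otimes> s = s' \<otimes> t [^] (k'::int)"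
    proof -
      have one: "\<one> \<in> ?P (Suc N ^ c)" by (auto intro!: one_in_set_pow simp: symmetrize_def)
      from s consider "s \<in> symmetrize G T" | "s = t" | "s = inv t"
        by (auto simp: symmetrize_def)
      then show ?thesis
      proof cases
        case 1
        then have sG: "s \<in> carrier G" using Y by auto
        have "t [^] k \<otimes> s \<otimes> inv (t [^] k) \<in> ?P (Suc N ^ c)"
          using k Suc.prems 1 by (intro conj_int_pow_length[OF c T t comm]) auto
        moreover have "t [^] k \<otimes> s = (t [^] k \<otimes> s \<otimes> inv (t [^] k)) \<otimes> t [^] k"
          using sG t by (simp add: m_assoc)
        ultimately show ?thesis using k by (intro exI[of _ "t [^] k \<otimes> s \<otimes> inv (t [^] k)"] exI[of _ k]) auto
      next
        case 2
        then have "t [^] k \<otimes> s = \<one> \<otimes> t [^] (k + 1)" using t by (simp add: int_pow_mult)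
        then show ?thesis using one k by (intro exI[of _ \<one>] exI[of _ "k + 1"]) auto
      next
        case 3
        then have "t [^] k \<otimes> s = \<one> \<otimes> t [^] (k - 1)" using t by (simp add: int_pow_diff)
        then show ?thesis using one k by (intro exI[of _ \<one>] exI[of _ "k - 1"]) auto
      qed
    qed
    then obtain s' k' where s': "s' \<in> ?P (Suc N ^ c)" and k': "\<bar>k'\<bar> \<le> int (Suc n)"
      and eq: "t [^] k \<otimes> s = s' \<otimes> t [^] (k'::int)" by blast
    have s'G: "s' \<in> carrier G" using s' set_pow_closed[OF Y] by auto
    have sG: "s \<in> carrier G" using s symmetrize_closed[of "insert t T"] T t by auto
    have "x = (y \<otimes> s') \<otimes> t [^] k'"
      using x zy yG s'G sG t eq by (simp add: m_assoc)
    moreover have "y \<otimes> s' \<in> ?P (Suc n * Suc N ^ c)"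
      using set_pow_mult_mem[OF Y y s'] by (simp add: add.commute)
    moreover have "t [^] k' \<in> (\<lambda>k::int. t [^] k) ` {-int (Suc n)..int (Suc n)}"
      using k' by (intro imageI) auto
    ultimately show "x \<in> ?P (Suc n * Suc N ^ c) <#> (\<lambda>k::int. t [^] k) ` {-int (Suc n)..int (Suc n)}"
      by (auto intro: set_mult_memI)
  qed
qed

lemma card_set_mult_le: "finite A \<Longrightarrow> finite B \<Longrightarrow> card (A <#> B) \<le> card A * card B"
proof -
  assume "finite A" "finite B"
  have "A <#> B = (\<lambda>(a, b). a \<otimes> b) ` (A \<times> B)" by (auto simp: set_mult_def)
  then show ?thesis
    using \<open>finite A\<close> \<open>finite B\<close> card_image_le[of "A \<times> B" "\<lambda>(a, b). a \<otimes> b"]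
    by (simp add: card_cartesian_product)
qed

text \<open>The collected form covers the ball of radius \<open>n\<close> by products of an element
  of a \<open>T\<close>-ball of polynomial radius with one of 2n + 1 powers of \<open>t\<close>. A
  polynomial bound at a polynomial radius is again polynomial.\<close>

lemma poly_growth_insert:
  assumes c: "lower_central G c = {\<one>}"
    and T: "T \<subseteq> carrier G" "finite T" and t: "t \<in> carrier G"
    and comm: "\<And>a. a \<in> T \<Longrightarrow> t \<otimes> a \<otimes> inv t \<otimes> inv a \<in> T"
      "\<And>a. a \<in> T \<Longrightarrow> inv t \<otimes> a \<otimes> t \<otimes> inv a \<in> T"
    and "poly_growth G T"
  shows "poly_growth G (insert t T)"
proof -
  from \<open>poly_growth G T\<close> obtain C D
    where CD: "\<And>n. card (set_pow G (symmetrize G T) n) \<le> C * Suc n ^ D"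
    unfolding poly_growth_def by blast
  have "card (set_pow G (symmetrize G (insert t T)) n) \<le> (2 * C) * Suc n ^ (Suc c * D + 1)" for n
  proof -
    let ?A = "set_pow G (symmetrize G T) (n * Suc n ^ c)"
    let ?B = "(\<lambda>k::int. t [^] k) ` {-int n..int n}"
    have fin: "finite ?A" "finite ?B"
      using T by (auto intro!: finite_set_pow finite_symmetrize)
    have "card (set_pow G (symmetrize G (insert t T)) n) \<le> card (?A <#> ?B)"
      using set_pow_insert_subset[OF c T(1) t comm order_refl, of n] fin
      by (intro card_mono finite_set_mult) auto
    also have "\<dots> \<le> card ?A * card ?B" using fin by (rule card_set_mult_le)
    also have "\<dots> \<le> (C * Suc (n * Suc n ^ c) ^ D) * (2 * Suc n)"
    proof (intro mult_mono CD)
      have "card ?B \<le> card {-int n..int n}" by (intro card_image_le) auto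
      then show "card ?B \<le> 2 * Suc n" by simp
    qed auto
    also have "\<dots> \<le> (C * (Suc n ^ Suc c) ^ D) * (2 * Suc n)"
    proof -
      have "Suc (n * Suc n ^ c) \<le> Suc n ^ Suc c"
        using one_le_power[of "Suc n" c] by simp
      then show ?thesis by (intro mult_mono power_mono) auto
    qed
    also have "\<dots> = (2 * C) * Suc n ^ (Suc c * D + 1)"
      by (simp only: power_add power_one_right power_mult[of "Suc n" "Suc c" D, symmetric] mult_ac)
    finally show ?thesis .
  qed
  then show ?thesis unfolding poly_growth_def by blast
qed

text \<open>Commutators with \<open>t\<close> and \<open>inv t\<close> are iterated; every round
  goes one step down the lower central series, so after \<open>c\<close> rounds only the identity
  can remain and the process stops.\<close>

lemma finite_commutator_closure:
  assumes c: "lower_central G c = {\<one>}" and t: "t \<in> carrier G"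
    and T: "finite T" "T \<subseteq> lower_central G n"
  obtains T' where "finite T'" "T \<subseteq> T'" "T' \<subseteq> lower_central G n"
    "\<And>a. a \<in> T' \<Longrightarrow> t \<otimes> a \<otimes> inv t \<otimes> inv a \<in> T'"
    "\<And>a. a \<in> T' \<Longrightarrow> inv t \<otimes> a \<otimes> t \<otimes> inv a \<in> T'"
proof -
  define f where "f A = (\<lambda>a. t \<otimes> a \<otimes> inv t \<otimes> inv a) ` A \<union> (\<lambda>a. inv t \<otimes> a \<otimes> t \<otimes> inv a) ` A" for A
  have f_lc: "f A \<subseteq> lower_central G (Suc m)" if "A \<subseteq> lower_central G m" for A m
    using that t commutator_in_lower_central[of t _ m] commutator_in_lower_central[of "inv t" _ m]
    unfolding f_def by auto
  \<comment> \<open>The identity is inserted because the round after the last one can only produce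
    \<open>\<one>\<close>, and \<open>f\<close> maps \<open>\<one>\<close> to itself.\<close>
  define T' where "T' = insert \<one> (\<Union>j\<le>c. (f ^^ j) T)"
  have sub: "(f ^^ j) T \<subseteq> lower_central G n" for j
  proof (induction j)
    case (Suc j)
    then show ?case using f_lc[OF Suc] lower_central_Suc_subset[of n] by (auto simp del: lower_central.simps)
  qed (use T in simp)
  have sub': "(f ^^ j) T \<subseteq> lower_central G j" for j
  proof (induction j)
    case (Suc j)
    then show ?case using f_lc[OF Suc] by (simp del: lower_central.simps)
  qed (use T lower_central_closed[of n] in auto)
  have one: "\<one> \<in> lower_central G n"
    by (cases n) (auto intro: generate.one)
  have fin: "finite ((f ^^ j) T)" for j
    by (induction j) (auto simp: f_def T)
  have "f T' \<subseteq> T'"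
  proof -
    have "f T' = f {\<one>} \<union> (\<Union>j\<le>c. f ((f ^^ j) T))"
      unfolding T'_def f_def by auto
    moreover have "f {\<one>} = {\<one>}" using t by (auto simp: f_def)
    moreover have "f ((f ^^ j) T) \<subseteq> T'" if "j \<le> c" for j
    proof (cases "j = c")
      case True
      then have "f ((f ^^ j) T) \<subseteq> f {\<one>}" using sub'[of c] c by (auto simp: f_def)
      then show ?thesis using \<open>f {\<one>} = {\<one>}\<close> by (auto simp: T'_def)
    next
      case False
      then have "(f ^^ Suc j) T \<subseteq> T'" using that unfolding T'_def by (intro subset_insertI2 UN_upper) auto
      then show ?thesis by simp
    qed
    ultimately show ?thesis by (auto simp: T'_def)
  qed
  moreover have "T \<subseteq> T'"
  proof -
    have "(f ^^ 0) T \<subseteq> (\<Union>j\<le>c. (f ^^ j) T)" by (intro UN_upper) auto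
    then show ?thesis by (auto simp: T'_def)
  qed
  ultimately show ?thesis
  proof (intro that[of T'])
    show "finite T'" using fin by (simp add: T'_def)
    show "T' \<subseteq> lower_central G n" using sub one by (auto simp: T'_def)
  qed (auto simp: f_def)
qed

text \<open>The induction climbs the lower central series from its trivial end. Within one layer the
  generators are adjoined one at a time by \<open>poly_growth_insert\<close>, whose commutator
  conditions hold because commutators with the new generator fall into the next smaller
  layer.\<close>

lemma nilpotent_poly_growth:
  assumes "nilpotent_group G" "finite S" "S \<subseteq> carrier G"
  shows "poly_growth G S"
proof -
  obtain c where c: "lower_central G c = {\<one>}"
    using assms unfolding nilpotent_group_def by blast
  have "\<And>T. finite T \<Longrightarrow> T \<subseteq> lower_central G (c - v) \<Longrightarrow> poly_growth G T" if "v \<le> c" for v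
    using that
  proof (induction v)
    case 0
    have "set_pow G (symmetrize G {\<one>}) n = {\<one>}" for n
      by (induction n) (auto simp: symmetrize_def set_mult_def)
    then have "poly_growth G {\<one>}"
      unfolding poly_growth_def by (intro exI[of _ 1] exI[of _ 0]) simp
    then show ?case
      using poly_growth_mono[of G "{\<one>}" T] 0 c by auto
  next
    case (Suc v)
    have eq: "Suc (c - Suc v) = c - v" using Suc.prems by simp
    have lc: "lower_central G (c - v) \<subseteq> carrier G" "lower_central G (c - Suc v) \<subseteq> carrier G"
      by (rule lower_central_closed)+
    \<comment> \<open>The quantifier over all finite \<open>T\<close> in the smaller layer is
      essential: adjoining a generator forces \<open>T\<close> to be enlarged before the induction
      hypothesis for \<open>S\<close> is applied.\<close>
    have "\<And>T. finite T \<Longrightarrow> T \<subseteq> lower_central G (c - v) \<Longrightarrow> poly_growth G (S \<union> T)"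
      if "finite S" "S \<subseteq> lower_central G (c - Suc v)" for S
      using that
    proof (induction S)
      case empty
      then show ?case using Suc by simp
    next
      case (insert t S)
      have t: "t \<in> carrier G" using insert.prems lc by auto
      \<comment> \<open>The commutators of \<open>t\<close> with the earlier generators are put into
        the smaller layer, so that after closing up, \<open>S \<union> T'\<close> is stable under
        commutators with \<open>t\<close>.\<close>
      let ?T0 = "T \<union> ((\<lambda>a. t \<otimes> a \<otimes> inv t \<otimes> inv a) ` S \<union> (\<lambda>a. inv t \<otimes> a \<otimes> t \<otimes> inv a) ` S)"
      have "t \<otimes> a \<otimes> inv t \<otimes> inv a \<in> lower_central G (c - v)"
        "inv t \<otimes> a \<otimes> t \<otimes> inv a \<in> lower_central G (c - v)" if "a \<in> S" for a
        using commutator_in_lower_central[of t a "c - Suc v"]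
          commutator_in_lower_central[of "inv t" a "c - Suc v"] that insert.prems t
        unfolding eq by auto
      then have T0: "finite ?T0" "?T0 \<subseteq> lower_central G (c - v)"
        using insert by auto
      obtain T' where T': "finite T'" "?T0 \<subseteq> T'" "T' \<subseteq> lower_central G (c - v)"
        "\<And>a. a \<in> T' \<Longrightarrow> t \<otimes> a \<otimes> inv t \<otimes> inv a \<in> T'"
        "\<And>a. a \<in> T' \<Longrightarrow> inv t \<otimes> a \<otimes> t \<otimes> inv a \<in> T'"
        by (rule finite_commutator_closure[OF c t T0]) (rule that)
      have "poly_growth G (insert t (S \<union> T'))"
      proof (rule poly_growth_insert[OF c _ _ t])
        show "poly_growth G (S \<union> T')" using insert T' by auto
      qed (use insert T' lc in auto)
      then show ?case
        by (rule poly_growth_mono) (use T' insert in auto)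
    qed
    from this[of T "{}"] Suc.prems show ?case by simp
  qed
  from this[of c S] assms show ?thesis by simp
qed

end

section \<open>Doubling at arbitrarily large scales\<close>

lemma set_pow_subgroup_generated: "set_pow (subgroup_generated G A) S n = set_pow G S n"
  by (induction n) (simp_all add: set_mult_def)

text \<open>If multiplying the radius by 5 always multiplied the size by more than 5 to the power
  \<open>D + 1\<close> from some scale on, the sizes along a geometric sequence of radii would
  outgrow the polynomial bound of degree \<open>D\<close>.\<close>

lemma poly_growth_doubling:
  assumes "poly_growth G T" "\<And>n. card (set_pow G (symmetrize G T) n) > 0"
  shows "\<exists>K>0. \<forall>m. \<exists>q\<ge>m. card (set_pow G (symmetrize G T) (5 * q)) \<le> K * card (set_pow G (symmetrize G T) q)"
proof -
  define a where "a n = card (set_pow G (symmetrize G T) n)" for n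
  obtain C D where CD: "\<And>n. a n \<le> C * Suc n ^ D"
    using assms(1) unfolding poly_growth_def a_def by blast
  let ?K = "5 ^ Suc D :: nat"
  have "\<exists>q\<ge>m. a (5 * q) \<le> ?K * a q" for m
  proof (rule ccontr)
    assume "\<not> ?thesis"
    then have step: "?K * a q \<le> a (5 * q)" if "q \<ge> m" for q using that by force
    let ?q = "Suc m"
    have low: "?K ^ k \<le> a (5 ^ k * ?q)" for k
    proof (induction k)
      case 0
      then show ?case using assms(2)[of ?q] by (simp add: a_def Suc_le_eq)
    next
      case (Suc k)
      have "m \<le> 5 ^ k * ?q" using mult_le_mono1[of 1 "5 ^ k" ?q] by simp
      then have "?K * a (5 ^ k * ?q) \<le> a (5 * (5 ^ k * ?q))" by (rule step)
      with mult_le_mono2[OF Suc, of ?K] have "?K * ?K ^ k \<le> a (5 * (5 ^ k * ?q))"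
        by (rule le_trans)
      then show ?case by (simp only: power_Suc mult.assoc)
    qed
    let ?B = "C * (Suc ?q) ^ D"
    \<comment> \<open>Lower and upper bound at radius \<open>5 ^ k * ?q\<close> share the factor
      \<open>(5 ^ k) ^ D\<close>; cancelling it leaves an exponential bounded by the constant
      \<open>?B\<close>, which fails at \<open>k = ?B\<close>.\<close>
    have "5 ^ k \<le> ?B" for k :: nat
    proof -
      have "5 ^ k * (5 ^ k) ^ D = ?K ^ k"
        by (simp add: power_mult[symmetric] mult.commute power_mult_distrib)
      also have "\<dots> \<le> C * Suc (5 ^ k * ?q) ^ D" using low[of k] CD[of "5 ^ k * ?q"] by linarith
      also have "\<dots> \<le> C * (5 ^ k * Suc ?q) ^ D"
        by (intro mult_le_mono power_mono) auto
      also have "\<dots> = ?B * (5 ^ k) ^ D" by (simp only: power_mult_distrib mult_ac)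
      finally show ?thesis by (subst (asm) mult_le_cancel2) simp
    qed
    moreover have "?B < 2 ^ ?B" "(2::nat) ^ ?B \<le> 5 ^ ?B"
      by (rule less_exp) (rule power_mono, simp_all)
    ultimately show False by (metis not_le less_le_trans)
  qed
  then show ?thesis unfolding a_def by (intro exI[of _ ?K]) auto
qed

text \<open>Word balls of \<open>T\<close> are the same in \<open>G\<close> and in the subgroup
  generated by \<open>T\<close>, and the latter is nilpotent.\<close>

lemma locally_nilpotent_doubling:
  assumes "locally_nilpotent_group G" "finite T" "T \<subseteq> carrier G"
  shows "\<exists>K>0. \<forall>m. \<exists>q\<ge>m. card (set_pow G (symmetrize G T) (5 * q)) \<le> K * card (set_pow G (symmetrize G T) q)"
proof -
  interpret group G using assms by (simp add: locally_nilpotent_group_def)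
  let ?H = "subgroup_generated G T"
  interpret H: group ?H by simp
  have TH: "T \<subseteq> carrier ?H" using assms subgroup_generated_subset_carrier_subset by blast
  have "symmetrize ?H T = symmetrize G T"
  proof -
    have "m_inv ?H ` T = m_inv G ` T"
      using TH by (intro image_cong) auto
    then show ?thesis by (simp add: symmetrize_def)
  qed
  moreover have "poly_growth ?H T"
    using assms TH by (intro H.nilpotent_poly_growth) (auto simp: locally_nilpotent_group_def)
  moreover have "card (set_pow G (symmetrize G T) n) > 0" for n
    using assms one_in_set_pow[of "symmetrize G T" n]
    by (auto simp: card_gt_0_iff symmetrize_def intro!: finite_set_pow)
  ultimately show ?thesis
    by (intro poly_growth_doubling) (auto simp: poly_growth_def set_pow_subgroup_generated)
qed

section \<open>Free continuous actions\<close>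

lemma eventually_nhdsin_self: "eventually P (nhdsin X x) \<Longrightarrow> x \<in> topspace X \<Longrightarrow> P x"
  by (auto simp: eventually_nhdsin)

lemma eventually_nhdsin_open: "openin X U \<Longrightarrow> x \<in> U \<Longrightarrow> \<forall>\<^sub>F y in nhdsin X x. y \<in> U"
  unfolding eventually_nhdsin by blast

lemma eventually_nhdsin_clopen:
  assumes "openin X U" "closedin X U"
  shows "\<forall>\<^sub>F y in nhdsin X x. (y \<in> U) = (x \<in> U)"
proof (cases "x \<in> U")
  case True
  then show ?thesis using assms(1) unfolding eventually_nhdsin by (intro disjI2 exI[of _ U]) auto
next
  case False
  then show ?thesis
    using assms(2) unfolding eventually_nhdsin
    by (cases "x \<in> topspace X") (auto intro!: exI[of _ "topspace X - U"])
qed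

text \<open>Rational-type balls around a countable dense set form a countable base. For each pair of
  such balls with a clopen set in between, one clopen set is chosen, and countably many choices
  still form a base.\<close>

lemma Polish_zero_dimensional_clopen_base:
  assumes "Polish_space X" "zero_dimensional X"
  obtains W :: "nat \<Rightarrow> 'a set" where "\<And>k. openin X (W k)" "\<And>k. closedin X (W k)"
    "\<And>U x. openin X U \<Longrightarrow> x \<in> U \<Longrightarrow> \<exists>k. x \<in> W k \<and> W k \<subseteq> U"
proof -
  from assms(1) have "metrizable_space X" "separable_space X"
    by (auto simp: Polish_space_def completely_metrizable_imp_metrizable_space)
  then obtain M d where "Metric_space M d" and X: "X = Metric_space.mtopology M d"
    by (auto simp: metrizable_space_def)
  then interpret Metric_space M d by simp
  obtain C where C: "countable C" "C \<subseteq> M" "X closure_of C = M"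
    using \<open>separable_space X\<close> X by (auto simp: separable_space_def)
  define \<B> where "\<B> = (\<lambda>(c, n). mball c (1 / real (Suc n))) ` (C \<times> UNIV)"
  have \<B>: "\<exists>V\<in>\<B>. x \<in> V \<and> V \<subseteq> U" if "openin X U" "x \<in> U" for U x
  proof -
    from that obtain r where r: "r > 0" "mball x r \<subseteq> U" and x: "x \<in> M"
      unfolding X openin_mtopology by blast
    then obtain n where n: "1 / real (Suc n) < r / 2"
      using nat_approx_posE[of "r / 2"] by auto
    have "openin X (mball x (1 / real (Suc n)))" "x \<in> mball x (1 / real (Suc n))"
      using x by (auto simp: X)
    moreover have "x \<in> X closure_of C" using C(3) x by simp
    ultimately obtain c where c: "c \<in> C" "c \<in> mball x (1 / real (Suc n))"
      unfolding in_closure_of by meson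
    have "mball c (1 / real (Suc n)) \<subseteq> mball x r"
    proof
      fix z assume z: "z \<in> mball c (1 / real (Suc n))"
      then have "d x z \<le> d x c + d c z" using c x by (intro triangle) auto
      then show "z \<in> mball x r" using c z n x by auto
    qed
    moreover have "x \<in> mball c (1 / real (Suc n))" using c x commute[of x c] by auto
    ultimately show ?thesis using r c by (auto simp: \<B>_def)
  qed
  define clp where "clp A B D \<longleftrightarrow> openin X D \<and> closedin X D \<and> A \<subseteq> D \<and> D \<subseteq> B" for A B D
  define pick where "pick A B = (SOME D. clp A B D)" for A B
  have pick: "clp A B (pick A B)" if "clp A B D" for A B D
    unfolding pick_def using that by (rule someI)
  define \<C> where "\<C> = (\<lambda>(A, B). pick A B) ` {(A, B) \<in> \<B> \<times> \<B>. \<exists>D. clp A B D}"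
  have clopen: "openin X D \<and> closedin X D" if "D \<in> \<C>" for D
  proof -
    obtain A B D' where "clp A B D'" "D = pick A B"
      using \<open>D \<in> \<C>\<close> unfolding \<C>_def by auto
    then show ?thesis using pick by (simp add: clp_def)
  qed
  have base: "\<exists>D\<in>\<C>. x \<in> D \<and> D \<subseteq> U" if U: "openin X U" "x \<in> U" for U x
  proof -
    obtain B where B: "B \<in> \<B>" "x \<in> B" "B \<subseteq> U" using \<B>[OF U] by blast
    then have "openin X B" by (auto simp: \<B>_def X)
    then obtain D where D: "openin X D" "closedin X D" "x \<in> D" "D \<subseteq> B"
      using assms(2) B
      unfolding zero_dimensional_def dimension_le_0_neighbourhood_base_of_clopen neighbourhood_base_of
      by (metis subset_iff)
    obtain A where A: "A \<in> \<B>" "x \<in> A" "A \<subseteq> D" using \<B>[OF D(1,3)] by blast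
    have clp: "clp A B D" using A D by (simp add: clp_def)
    then have "pick A B \<in> \<C>"
      unfolding \<C>_def using A B by (intro image_eqI[of _ _ "(A, B)"]) auto
    then show ?thesis using pick[OF clp] A B by (intro bexI[of _ "pick A B"]) (auto simp: clp_def)
  qed
  have "countable \<C>"
  proof -
    have "countable \<B>" unfolding \<B>_def using C(1) by (intro countable_image) auto
    moreover have "\<C> \<subseteq> (\<lambda>(A, B). pick A B) ` (\<B> \<times> \<B>)" unfolding \<C>_def by (intro image_mono) auto
    ultimately show ?thesis by (meson countable_SIGMA countable_image countable_subset)
  qed
  \<comment> \<open>The empty set guarantees a nonempty family to enumerate even when
    \<open>X\<close> is empty.\<close>
  define \<C>' where "\<C>' = insert {} \<C>"
  have "countable \<C>'" "\<C>' \<noteq> {}" using \<open>countable \<C>\<close> by (auto simp: \<C>'_def)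
  then have range: "range (from_nat_into \<C>') = \<C>'" by (rule range_from_nat_into[rotated])
  show thesis
  proof (rule that[of "from_nat_into \<C>'"])
    fix k
    have "from_nat_into \<C>' k \<in> \<C>'" using range by auto
    then show "openin X (from_nat_into \<C>' k)" "closedin X (from_nat_into \<C>' k)"
      using clopen by (auto simp: \<C>'_def)
  next
    fix U x assume "openin X U" "x \<in> U"
    then obtain D where "D \<in> \<C>'" "x \<in> D" "D \<subseteq> U" using base by (fastforce simp: \<C>'_def)
    moreover from this obtain k where "from_nat_into \<C>' k = D"
      using from_nat_into_surj[OF \<open>countable \<C>'\<close>] by blast
    ultimately show "\<exists>k. x \<in> from_nat_into \<C>' k \<and> from_nat_into \<C>' k \<subseteq> U" by blast
  qed
qed

section \<open>Locally constant data and maps along orbits\<close>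

definition loc_const :: "'a topology \<Rightarrow> ('a \<Rightarrow> 'b) \<Rightarrow> bool" where
  "loc_const X f \<longleftrightarrow> (\<forall>x\<in>topspace X. \<forall>\<^sub>F y in nhdsin X x. f y = f x)"

text \<open>Such a set generates the subgroup whose word metric is considered, which may be a proper
  subgroup of \<open>G\<close>.\<close>

definition generating :: "('g, 'c) monoid_scheme \<Rightarrow> 'g set \<Rightarrow> bool" where
  "generating G S \<longleftrightarrow> S \<subseteq> carrier G \<and> finite S \<and> \<one>\<^bsub>G\<^esub> \<in> S \<and> (\<forall>s\<in>S. inv\<^bsub>G\<^esub> s \<in> S)"

locale free_continuous_action = group G + group_action G "topspace X" \<phi>
  for G :: "('g, 'c) monoid_scheme" (structure) and X :: "'a topology" and \<phi> :: "'g \<Rightarrow> 'a \<Rightarrow> 'a" +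
  assumes continuous_act: "g \<in> carrier G \<Longrightarrow> continuous_map X X (\<phi> g)"
    and free: "g \<in> carrier G \<Longrightarrow> x \<in> topspace X \<Longrightarrow> \<phi> g x = x \<Longrightarrow> g = \<one>"
begin

lemma act_closed [simp]: "g \<in> carrier G \<Longrightarrow> x \<in> topspace X \<Longrightarrow> \<phi> g x \<in> topspace X"
  by (rule element_image) auto

lemma act_mult: "g \<in> carrier G \<Longrightarrow> h \<in> carrier G \<Longrightarrow> x \<in> topspace X \<Longrightarrow> \<phi> g (\<phi> h x) = \<phi> (g \<otimes> h) x"
  by (simp add: composition_rule)

lemma act_one [simp]: "x \<in> topspace X \<Longrightarrow> \<phi> \<one> x = x"
  using id_eq_one by (metis restrict_apply')

text \<open>Freeness makes the element carrying one point of an orbit to another unique; all later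
  counting in orbits rests on this.\<close>

lemma act_eq_iff:
  assumes "g \<in> carrier G" "h \<in> carrier G" "x \<in> topspace X"
  shows "\<phi> g x = \<phi> h x \<longleftrightarrow> g = h"
proof
  assume "\<phi> g x = \<phi> h x"
  then have "\<phi> (inv h \<otimes> g) x = \<phi> (inv h \<otimes> h) x"
    using assms by (simp only: act_mult[symmetric] inv_closed)
  then have "inv h \<otimes> g = \<one>"
    using assms by (intro free[of _ x]) auto
  then show "g = h"
    using assms by (metis inv_closed inv_equality inv_inv)
qed simp

lemma eventually_act:
  assumes "g \<in> carrier G" "x \<in> topspace X" "eventually P (nhdsin X (\<phi> g x))"
  shows "\<forall>\<^sub>F y in nhdsin X x. P (\<phi> g y)"
proof -
  obtain U where U: "openin X U" "\<phi> g x \<in> U" "\<And>y. y \<in> U \<Longrightarrow> P y"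
    using assms by (auto simp: eventually_nhdsin)
  have "openin X {y \<in> topspace X. \<phi> g y \<in> U}"
    using continuous_act[OF assms(1)] U(1) by (simp add: continuous_map_def)
  then show ?thesis
    unfolding eventually_nhdsin using U assms
    by (intro disjI2 exI[of _ "{y \<in> topspace X. \<phi> g y \<in> U}"]) auto
qed

lemma eventually_in_topspace: "\<forall>\<^sub>F y in nhdsin X x. y \<in> topspace X"
  unfolding eventually_nhdsin by (cases "x \<in> topspace X") (auto intro!: exI[of _ "topspace X"])

lemma loc_const_act: "loc_const X f \<Longrightarrow> g \<in> carrier G \<Longrightarrow> loc_const X (\<lambda>x. f (\<phi> g x))"
  unfolding loc_const_def by (auto intro!: eventually_act)

text \<open>The finite set \<open>B\<close> is uniform over \<open>X\<close> and the element is
  chosen locally constantly, so a tame map is continuous and moves points inside their orbits by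
  bounded amounts.\<close>

definition tame :: "'g set \<Rightarrow> ('a \<Rightarrow> 'a) \<Rightarrow> bool" where
  "tame B P \<longleftrightarrow> finite B \<and> B \<subseteq> carrier G \<and>
     (\<forall>x\<in>topspace X. \<exists>g\<in>B. \<forall>\<^sub>F y in nhdsin X x. P y = \<phi> g y)"

lemma tame_id: "tame {\<one>} (\<lambda>x. x)"
  unfolding tame_def by (auto intro: eventually_mono[OF eventually_in_topspace])

lemma tameE:
  assumes "tame B P" "x \<in> topspace X"
  obtains g where "g \<in> B" "g \<in> carrier G" "P x = \<phi> g x" "\<forall>\<^sub>F y in nhdsin X x. P y = \<phi> g y"
  using assms unfolding tame_def by (meson eventually_nhdsin_self subsetD)

lemma tame_closed: "tame B P \<Longrightarrow> x \<in> topspace X \<Longrightarrow> P x \<in> topspace X"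
  by (erule tameE, assumption) auto

lemma tame_comp:
  assumes P: "tame B P" and Q: "tame C Q"
  shows "tame (B <#> C) (\<lambda>x. P (Q x))"
  unfolding tame_def
proof (intro conjI ballI)
  show "finite (B <#> C)" "B <#> C \<subseteq> carrier G"
    using P Q by (auto simp: tame_def finite_set_mult set_mult_closed)
  fix x assume x: "x \<in> topspace X"
  obtain h where h: "h \<in> C" "h \<in> carrier G" "Q x = \<phi> h x" "\<forall>\<^sub>F y in nhdsin X x. Q y = \<phi> h y"
    using tameE[OF Q x] .
  obtain g where g: "g \<in> B" "g \<in> carrier G" "\<forall>\<^sub>F y in nhdsin X (\<phi> h x). P y = \<phi> g y"
    using tameE[OF P act_closed[OF h(2) x]] .
  have "\<forall>\<^sub>F y in nhdsin X x. P (Q y) = \<phi> (g \<otimes> h) y"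
    using h(4) eventually_act[OF h(2) x g(3)] eventually_in_topspace
    by eventually_elim (use h g in \<open>simp add: act_mult\<close>)
  then show "\<exists>g\<in>B <#> C. \<forall>\<^sub>F y in nhdsin X x. P (Q y) = \<phi> g y"
    using g h by (auto intro!: bexI[of _ "g \<otimes> h"] set_mult_memI)
qed

text \<open>Near a point both maps act by fixed group elements, and by freeness these agree at one
  point exactly when they are the same element.\<close>

lemma loc_const_tame_eq:
  assumes "tame B P" "tame C Q"
  shows "loc_const X (\<lambda>x. P x = Q x)"
  unfolding loc_const_def
proof
  fix x assume x: "x \<in> topspace X"
  obtain g where g: "g \<in> carrier G" "P x = \<phi> g x" "\<forall>\<^sub>F y in nhdsin X x. P y = \<phi> g y"
    using tameE[OF assms(1) x] .
  obtain h where h: "h \<in> carrier G" "Q x = \<phi> h x" "\<forall>\<^sub>F y in nhdsin X x. Q y = \<phi> h y"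
    using tameE[OF assms(2) x] .
  show "\<forall>\<^sub>F y in nhdsin X x. (P y = Q y) = (P x = Q x)"
    using g(3) h(3) eventually_in_topspace
    by eventually_elim (use x g h in \<open>simp add: act_eq_iff\<close>)
qed

lemma tame_act: "g \<in> carrier G \<Longrightarrow> tame {g} (\<phi> g)"
  by (simp add: tame_def)

lemma loc_const_tame:
  assumes "tame B P" "loc_const X f"
  shows "loc_const X (\<lambda>x. f (P x))"
  unfolding loc_const_def
proof
  fix x assume x: "x \<in> topspace X"
  obtain g where g: "g \<in> carrier G" "P x = \<phi> g x" "\<forall>\<^sub>F y in nhdsin X x. P y = \<phi> g y"
    using tameE[OF assms(1) x] .
  have "\<forall>\<^sub>F y in nhdsin X x. f (\<phi> g y) = f (\<phi> g x)"
    using loc_const_act[OF assms(2) g(1)] x by (simp add: loc_const_def)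
  with g(3) show "\<forall>\<^sub>F y in nhdsin X x. f (P y) = f (P x)"
    by eventually_elim (simp add: g)
qed

section \<open>Word-metric balls inside orbits\<close>

definition nbhd :: "'g set \<Rightarrow> nat \<Rightarrow> 'a \<Rightarrow> 'a set" where
  "nbhd S n x = (\<lambda>g. \<phi> g x) ` set_pow G S n"

text \<open>In terms of the equivalence relation with classes the fibres of \<open>P\<close>, this
  says that the ball around \<open>x\<close> is cut.\<close>

definition varies :: "'g set \<Rightarrow> ('a \<Rightarrow> 'a) \<Rightarrow> nat \<Rightarrow> 'a \<Rightarrow> bool" where
  "varies S P n x \<longleftrightarrow> (\<exists>y\<in>nbhd S n x. P y \<noteq> P x)"

lemma generatingD:
  assumes "generating G S"
  shows "S \<subseteq> carrier G" "finite S" "\<one> \<in> S" "\<And>s. s \<in> S \<Longrightarrow> inv s \<in> S"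
    "g \<in> set_pow G S n \<Longrightarrow> g \<in> carrier G"
  using assms set_pow_closed[of S n] by (auto simp: generating_def)

lemma finite_nbhd: "generating G S \<Longrightarrow> finite (nbhd S n x)"
  unfolding nbhd_def by (intro finite_imageI finite_set_pow generatingD)

context
  fixes S assumes S: "generating G S"
begin

lemma nbhd_closed: "x \<in> topspace X \<Longrightarrow> y \<in> nbhd S n x \<Longrightarrow> y \<in> topspace X"
  using generatingD(5)[OF S] by (auto simp: nbhd_def)

lemma nbhd_refl: "x \<in> topspace X \<Longrightarrow> x \<in> nbhd S n x"
  unfolding nbhd_def using one_in_set_pow[OF generatingD(3)[OF S]] by (intro image_eqI[of _ _ \<one>]) auto

lemma nbhd_mono: "m \<le> n \<Longrightarrow> nbhd S m x \<subseteq> nbhd S n x"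
  unfolding nbhd_def using set_pow_le[OF generatingD(1,3)[OF S]] by (intro image_mono)

lemma nbhd_sym:
  assumes "x \<in> topspace X" "y \<in> nbhd S n x"
  shows "x \<in> nbhd S n y"
proof -
  obtain g where g: "g \<in> set_pow G S n" "y = \<phi> g x"
    using assms unfolding nbhd_def by blast
  then have "x = \<phi> (inv g) y"
    using assms(1) generatingD(5)[OF S g(1)] by (simp add: act_mult)
  moreover have "inv g \<in> set_pow G S n"
    by (rule set_pow_inv[OF generatingD(1,4)[OF S] g(1)])
  ultimately show ?thesis unfolding nbhd_def by blast
qed

lemma nbhd_trans:
  assumes "x \<in> topspace X" "y \<in> nbhd S m x" "z \<in> nbhd S n y"
  shows "z \<in> nbhd S (m + n) x"
proof -
  obtain g h where g: "g \<in> set_pow G S m" "y = \<phi> g x" and h: "h \<in> set_pow G S n" "z = \<phi> h y"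
    using assms unfolding nbhd_def by blast
  then have "z = \<phi> (h \<otimes> g) x"
    using assms(1) generatingD(5)[OF S g(1)] generatingD(5)[OF S h(1)] by (simp add: act_mult)
  moreover have "h \<otimes> g \<in> set_pow G S (m + n)"
    using set_pow_mult_mem[OF generatingD(1)[OF S] h(1) g(1)] by (simp only: add.commute)
  ultimately show ?thesis unfolding nbhd_def by blast
qed

text \<open>By freeness membership in a ball depends on \<open>g\<close> alone and not on
  \<open>x\<close>, so the same condition can be transferred to all nearby points.\<close>

lemma nbhd_act_iff:
  assumes "g \<in> carrier G" "x \<in> topspace X"
  shows "x \<in> nbhd S n (\<phi> g x) \<longleftrightarrow> g \<in> set_pow G S n"
proof
  assume "x \<in> nbhd S n (\<phi> g x)"
  then have "\<phi> g x \<in> nbhd S n x" using nbhd_sym[OF act_closed[OF assms]] by blast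
  then show "g \<in> set_pow G S n"
    using assms generatingD(5)[OF S] by (auto simp: nbhd_def act_eq_iff)
next
  assume "g \<in> set_pow G S n"
  then show "x \<in> nbhd S n (\<phi> g x)"
    using assms by (intro nbhd_sym[OF assms(2)]) (auto simp: nbhd_def)
qed

lemma card_nbhd: "x \<in> topspace X \<Longrightarrow> card (nbhd S n x) = card (set_pow G S n)"
  unfolding nbhd_def using generatingD(5)[OF S] by (intro card_image inj_onI) (auto simp: act_eq_iff)

lemma loc_const_varies:
  assumes "tame B P"
  shows "loc_const X (varies S P n)"
  unfolding loc_const_def
proof
  fix x assume x: "x \<in> topspace X"
  have "\<forall>g\<in>set_pow G S n. \<forall>\<^sub>F y in nhdsin X x. (P (\<phi> g y) = P y) = (P (\<phi> g x) = P x)"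
  proof
    fix g assume "g \<in> set_pow G S n"
    then have "tame (B <#> {g}) (\<lambda>x. P (\<phi> g x))"
      using generatingD(5)[OF S] by (intro tame_comp assms tame_act)
    from loc_const_tame_eq[OF this assms] x
    show "\<forall>\<^sub>F y in nhdsin X x. (P (\<phi> g y) = P y) = (P (\<phi> g x) = P x)"
      by (simp add: loc_const_def)
  qed
  then have "\<forall>\<^sub>F y in nhdsin X x. \<forall>g\<in>set_pow G S n. (P (\<phi> g y) = P y) = (P (\<phi> g x) = P x)"
    by (intro eventually_ball_finite finite_set_pow generatingD[OF S])
  then show "\<forall>\<^sub>F y in nhdsin X x. varies S P n y = varies S P n x"
    by eventually_elim (simp add: varies_def nbhd_def)
qed

end

end

section \<open>Colourings and maximal separated sets\<close>

locale free_continuous_action_base = free_continuous_action G X \<phi>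
  for G :: "('g, 'c) monoid_scheme" (structure) and X :: "'a topology" and \<phi> :: "'g \<Rightarrow> 'a \<Rightarrow> 'a" +
  fixes W :: "nat \<Rightarrow> 'a set"
  assumes W_clopen: "openin X (W k)" "closedin X (W k)"
    and W_base: "openin X U \<Longrightarrow> x \<in> U \<Longrightarrow> \<exists>k. x \<in> W k \<and> W k \<subseteq> U"
    and Hausdorff: "Hausdorff_space X"
begin

text \<open>Since the action is free and \<open>X\<close> is Hausdorff, each point has a basic
  clopen neighbourhood disjoint from its translates by \<open>A\<close>. The colour is the least
  index of such a neighbourhood.\<close>

lemma ex_coloring:
  assumes A: "finite A" "A \<subseteq> carrier G" "\<one> \<notin> A"
  obtains col :: "'a \<Rightarrow> nat" where "loc_const X col"
    "\<And>x g. x \<in> topspace X \<Longrightarrow> g \<in> A \<Longrightarrow> col (\<phi> g x) \<noteq> col x"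
proof -
  define good where "good k \<longleftrightarrow> (\<forall>y\<in>W k. \<forall>g\<in>A. \<phi> g y \<notin> W k)" for k
  have ex: "\<exists>k. x \<in> W k \<and> good k" if x: "x \<in> topspace X" for x
  proof -
    have "\<forall>g\<in>A. \<exists>U V. openin X U \<and> openin X V \<and> x \<in> U \<and> \<phi> g x \<in> V \<and> disjnt U V"
    proof
      fix g assume "g \<in> A"
      then have "x \<noteq> \<phi> g x" "\<phi> g x \<in> topspace X" using A x free[of g x] by auto
      then show "\<exists>U V. openin X U \<and> openin X V \<and> x \<in> U \<and> \<phi> g x \<in> V \<and> disjnt U V"
        using Hausdorff x by (auto simp: Hausdorff_space_def)
    qed
    then obtain U V where UV: "\<And>g. g \<in> A \<Longrightarrow> openin X (U g)" "\<And>g. g \<in> A \<Longrightarrow> openin X (V g)"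
      "\<And>g. g \<in> A \<Longrightarrow> x \<in> U g" "\<And>g. g \<in> A \<Longrightarrow> \<phi> g x \<in> V g" "\<And>g. g \<in> A \<Longrightarrow> disjnt (U g) (V g)"
      by metis
    have "\<forall>g\<in>A. \<forall>\<^sub>F y in nhdsin X x. y \<in> U g \<and> \<phi> g y \<in> V g"
    proof
      fix g assume g: "g \<in> A"
      have "\<forall>\<^sub>F y in nhdsin X x. y \<in> U g" "\<forall>\<^sub>F y in nhdsin X (\<phi> g x). y \<in> V g"
        using UV g by (auto intro: eventually_nhdsin_open)
      then show "\<forall>\<^sub>F y in nhdsin X x. y \<in> U g \<and> \<phi> g y \<in> V g"
        using eventually_act[of g x] A g x by (intro eventually_conj) auto
    qed
    then have "\<forall>\<^sub>F y in nhdsin X x. \<forall>g\<in>A. y \<in> U g \<and> \<phi> g y \<in> V g"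
      by (intro eventually_ball_finite A)
    then obtain O' where O': "openin X O'" "x \<in> O'" "\<And>y g. y \<in> O' \<Longrightarrow> g \<in> A \<Longrightarrow> y \<in> U g \<and> \<phi> g y \<in> V g"
      using x by (auto simp: eventually_nhdsin)
    obtain k where "x \<in> W k" "W k \<subseteq> O'" using W_base[OF O'(1,2)] by blast
    moreover from this have "good k"
      using O'(3) UV(5) unfolding good_def disjnt_iff by (meson subsetD)
    ultimately show ?thesis by blast
  qed
  define col where "col x = (LEAST k. x \<in> W k \<and> good k)" for x
  have col: "x \<in> W (col x) \<and> good (col x)" if "x \<in> topspace X" for x
    unfolding col_def using ex[OF that] by (rule LeastI_ex)
  show thesis
  proof (rule that)
    show "loc_const X col"
      unfolding loc_const_def
    proof
      fix x assume x: "x \<in> topspace X"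
      \<comment> \<open>Only the finitely many indices up to \<open>col x\<close> influence the
        minimum, and each \<open>W k\<close> is clopen.\<close>
      have "\<forall>\<^sub>F y in nhdsin X x. \<forall>k\<in>{..col x}. (y \<in> W k) = (x \<in> W k)"
        using W_clopen by (intro eventually_ball_finite ballI eventually_nhdsin_clopen) auto
      then show "\<forall>\<^sub>F y in nhdsin X x. col y = col x"
      proof eventually_elim
        case (elim y)
        show ?case
        proof (subst col_def, rule Least_equality)
          show "y \<in> W (col x) \<and> good (col x)" using elim col[OF x] by auto
          show "col x \<le> k" if "y \<in> W k \<and> good k" for k
          proof (rule ccontr)
            assume "\<not> col x \<le> k"
            then have "x \<in> W k \<and> good k" using elim that by auto
            then show False using \<open>\<not> col x \<le> k\<close> unfolding col_def by (metis Least_le)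
          qed
        qed
      qed
    qed
    show "col (\<phi> g x) \<noteq> col x" if "x \<in> topspace X" "g \<in> A" for x g
      using col[of x] col[of "\<phi> g x"] that A by (auto simp: good_def)
  qed
qed

text \<open>Points are selected greedily, colour by colour. Distinct points within distance
  \<open>r\<close> have different colours, so a whole colour class can be treated at once without
  conflict.\<close>

lemma ex_maximal_separated:
  assumes S: "generating G S"
  obtains M where "M \<subseteq> topspace X" "loc_const X (\<lambda>x. x \<in> M)"
    "\<And>x y. x \<in> M \<Longrightarrow> y \<in> M \<Longrightarrow> y \<in> nbhd S r x \<Longrightarrow> x = y"
    "\<And>x. x \<in> topspace X \<Longrightarrow> \<exists>m\<in>M. x \<in> nbhd S r m"
proof -
  obtain col :: "'a \<Rightarrow> nat" where col: "loc_const X col"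
    "\<And>x g. x \<in> topspace X \<Longrightarrow> g \<in> set_pow G S r - {\<one>} \<Longrightarrow> col (\<phi> g x) \<noteq> col x"
    using ex_coloring[of "set_pow G S r - {\<one>}"] generatingD[OF S]
    by (metis (no_types, lifting) DiffD1 DiffD2 finite_Diff finite_set_pow singletonI subsetI)
  define N where "N = rec_nat {} (\<lambda>n A. A \<union> {x \<in> topspace X. col x = n \<and> nbhd S r x \<inter> A = {}})"
  have N0: "N 0 = {}" and NS: "N (Suc n) = N n \<union> {x \<in> topspace X. col x = n \<and> nbhd S r x \<inter> N n = {}}" for n
    by (simp_all add: N_def)
  have N_less: "col x < n" "x \<in> topspace X" if "x \<in> N n" for x n
    using that by (induction n) (auto simp: N0 NS)
  have N_mono: "N m \<subseteq> N n" if "m \<le> n" for m n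
    using that by (induction n) (auto simp: N0 NS le_Suc_eq)
  \<comment> \<open>The decision about \<open>x\<close> is made at stage \<open>Suc (col x)\<close>
    and never changes; hence membership in \<open>M\<close> below is locally constant although
    infinitely many stages occur.\<close>
  have N_iff: "x \<in> N n \<longleftrightarrow> x \<in> N (Suc (col x)) \<and> col x < n" for x n
  proof
    assume "x \<in> N n"
    then show "x \<in> N (Suc (col x)) \<and> col x < n"
      by (induction n) (auto simp: N0 NS)
  qed (use N_mono[of "Suc (col x)" n] in auto)
  have lc_N: "loc_const X (\<lambda>x. x \<in> N n)" for n
  proof (induction n)
    case 0
    then show ?case by (simp add: N0 loc_const_def)
  next
    case (Suc n)
    show ?case
      unfolding loc_const_def
    proof
      fix x assume x: "x \<in> topspace X"
      have 1: "\<forall>\<^sub>F y in nhdsin X x. col y = col x" "\<forall>\<^sub>F y in nhdsin X x. (y \<in> N n) = (x \<in> N n)"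
        using col(1) Suc x by (auto simp: loc_const_def)
      have 2: "\<forall>\<^sub>F y in nhdsin X x. \<forall>g\<in>set_pow G S r. (\<phi> g y \<in> N n) = (\<phi> g x \<in> N n)"
        using loc_const_act[OF Suc] x generatingD(5)[OF S]
        by (intro eventually_ball_finite finite_set_pow generatingD(2)[OF S]) (auto simp: loc_const_def)
      show "\<forall>\<^sub>F y in nhdsin X x. (y \<in> N (Suc n)) = (x \<in> N (Suc n))"
        using 1 2 eventually_in_topspace
      proof eventually_elim
        case (elim y)
        then have "(nbhd S r y \<inter> N n = {}) = (nbhd S r x \<inter> N n = {})"
          by (auto simp: nbhd_def)
        with elim x show ?case by (simp add: NS)
      qed
    qed
  qed
  define M where "M = {x \<in> topspace X. x \<in> N (Suc (col x))}"
  have sep: "\<not> col x < col y" if "x \<in> M" "y \<in> M" "x \<in> nbhd S r y" for x y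
    using that N_less[of y "col y"] N_iff[of x "col y"] by (auto simp: M_def NS)
  show thesis
  proof (rule that)
    show "M \<subseteq> topspace X" by (auto simp: M_def)
    show "loc_const X (\<lambda>x. x \<in> M)"
      unfolding loc_const_def
    proof
      fix x assume x: "x \<in> topspace X"
      have "\<forall>\<^sub>F y in nhdsin X x. (y \<in> N (Suc (col x))) = (x \<in> N (Suc (col x)))"
        "\<forall>\<^sub>F y in nhdsin X x. col y = col x"
        using col(1) lc_N x by (auto simp: loc_const_def)
      then show "\<forall>\<^sub>F y in nhdsin X x. (y \<in> M) = (x \<in> M)"
        using eventually_in_topspace by eventually_elim (simp add: M_def x)
    qed
  next
    fix x y assume xy: "x \<in> M" "y \<in> M" "y \<in> nbhd S r x"
    then have X: "x \<in> topspace X" by (simp add: M_def)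
    have "col x = col y"
      using sep[of x y] sep[of y x] xy nbhd_sym[OF S X xy(3)] by auto
    moreover obtain g where g: "g \<in> set_pow G S r" "y = \<phi> g x" using xy by (auto simp: nbhd_def)
    ultimately have "g = \<one>" using col(2)[OF X, of g] by auto
    then show "x = y" using g X by simp
  next
    fix x assume x: "x \<in> topspace X"
    show "\<exists>m\<in>M. x \<in> nbhd S r m"
    proof (cases "nbhd S r x \<inter> N (col x) = {}")
      case True
      then have "x \<in> M" using x by (simp add: M_def NS)
      then show ?thesis using nbhd_refl[OF S x] by blast
    next
      case False
      then obtain m where m: "m \<in> nbhd S r x" "m \<in> N (col x)" by blast
      then have "m \<in> M" using N_less[of m] N_iff[of m "col x"] by (auto simp: M_def)
      then show ?thesis using nbhd_sym[OF S x m(1)] by blast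
    qed
  qed
qed

end

section \<open>Reducing the number of relations cut near a point\<close>

context free_continuous_action_base
begin

text \<open>The maps \<open>Q j\<close> are precomposed with roundings to marker points; at a marker \<open>m\<close>
  the radius of the cell used for \<open>j\<close> depends on the rank of \<open>j\<close> among the indices whose map
  varies near \<open>m\<close>. Hence each marker accounts for at most one index \<open>j\<close> that is cut near a
  given point, and doubling bounds the number of markers.\<close>

lemma ex_rounding:
  fixes K w H :: nat
  assumes S: "generating G S"
    and K: "\<And>m. \<exists>q\<ge>m. card (set_pow G S (5 * q)) \<le> K * card (set_pow G S q)"
  shows "\<exists>e E (op :: (nat \<Rightarrow> 'a \<Rightarrow> 'a) \<Rightarrow> nat \<Rightarrow> 'a \<Rightarrow> 'a).
    (\<forall>Q. (\<forall>j. \<exists>B. tame B (Q j)) \<longrightarrow> (\<forall>j. \<exists>B. tame B (op Q j))) \<and>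
    (\<forall>Q Q' j. (\<forall>i\<le>j. Q i = Q' i) \<longrightarrow> op Q j = op Q' j) \<and>
    (\<forall>Q j. \<forall>x\<in>topspace X. \<exists>y\<in>nbhd S e x. op Q j x = Q j y) \<and>
    (\<forall>Q N. (\<forall>x\<in>topspace X. card {j. j < N \<and> varies S (Q j) E x} \<le> H) \<longrightarrow>
           (\<forall>x\<in>topspace X. card {j. j < N \<and> varies S (op Q j) w x} \<le> K))"
proof -
  \<comment> \<open>The scale leaves room for \<open>H + 1\<close> radii starting at
    \<open>r = 2 * q\<close> in steps of \<open>2 * w + 1\<close>, all of them at most
    \<open>2 * r - w\<close>. The factor 5 is the radius \<open>2 * r + q\<close> of the packing
    argument at the end.\<close>
  obtain q where q: "q \<ge> H * (2 * w + 1) + w"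
    and Kq: "card (set_pow G S (5 * q)) \<le> K * card (set_pow G S q)"
    using K by blast
  define r where "r = 2 * q"
  define e where "e = r + (2 * w + 1) * H"
  \<comment> \<open>This is the length of the path from a marker to a point \<open>x\<close>, on to
    a point \<open>y\<close> within \<open>w\<close>, and then to the marker chosen for
    \<open>y\<close>.\<close>
  define E where "E = 2 * w + 2 * e"
  have le: "e + w \<le> 2 * r" "w \<le> r" "r \<le> e"
    using q by (auto simp: r_def e_def algebra_simps)
  obtain M where M: "M \<subseteq> topspace X" "loc_const X (\<lambda>x. x \<in> M)"
    "\<And>x y. x \<in> M \<Longrightarrow> y \<in> M \<Longrightarrow> y \<in> nbhd S r x \<Longrightarrow> x = y"
    "\<And>x. x \<in> topspace X \<Longrightarrow> \<exists>m\<in>M. x \<in> nbhd S r m"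
    using ex_maximal_separated[OF S, of r] by blast
  have "finite (set_pow G S (2 * e) - {\<one>})" "set_pow G S (2 * e) - {\<one>} \<subseteq> carrier G"
    "\<one> \<notin> set_pow G S (2 * e) - {\<one>}"
    using generatingD[OF S] by (auto intro: finite_set_pow)
  then obtain col :: "'a \<Rightarrow> nat" where col: "loc_const X col"
    "\<And>x g. x \<in> topspace X \<Longrightarrow> g \<in> set_pow G S (2 * e) - {\<one>} \<Longrightarrow> col (\<phi> g x) \<noteq> col x"
    using ex_coloring by blast
  \<comment> \<open>Only smaller indices are counted, so that \<open>op Q j\<close> depends on
    \<open>Q i\<close> for \<open>i \<le> j\<close> only.\<close>
  define rank where "rank Q j m = card {i. i < j \<and> varies S (Q i) E m}"
    for Q :: "nat \<Rightarrow> 'a \<Rightarrow> 'a" and j m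
  \<comment> \<open>Distinct ranks up to \<open>H\<close> give radii differing by at least
    \<open>2 * w + 1\<close>; truncation at \<open>H\<close> keeps every radius at most
    \<open>e\<close> for arbitrary \<open>Q\<close>.\<close>
  define rad where "rad Q j m = r + (2 * w + 1) * min H (rank Q j m)"
    for Q :: "nat \<Rightarrow> 'a \<Rightarrow> 'a" and j m
  define cand where "cand Q j x = {m \<in> M. x \<in> nbhd S (rad Q j m) m}"
    for Q :: "nat \<Rightarrow> 'a \<Rightarrow> 'a" and j x
  \<comment> \<open>Any two candidates for \<open>x\<close> are within \<open>2 * e\<close> of each
    other, so \<open>col\<close> separates them and the minimiser is unique.\<close>
  define p where "p Q j x = arg_min col (\<lambda>m. m \<in> cand Q j x)"
    for Q :: "nat \<Rightarrow> 'a \<Rightarrow> 'a" and j x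
  define op where "op Q j x = Q j (p Q j x)" for Q :: "nat \<Rightarrow> 'a \<Rightarrow> 'a" and j x
  have rad_le: "r \<le> rad Q j m" "rad Q j m \<le> e" for Q j m
    unfolding rad_def e_def by (simp, intro add_left_mono mult_le_mono2) simp
  have p_cand: "p Q j x \<in> cand Q j x" and p_min: "m \<in> cand Q j x \<Longrightarrow> col (p Q j x) \<le> col m"
    if x: "x \<in> topspace X" for Q j x m
  proof -
    obtain m where "m \<in> M" "x \<in> nbhd S r m" using M(4)[OF x] by blast
    then have "m \<in> cand Q j x" using nbhd_mono[OF S rad_le(1)[of Q j m]] by (auto simp: cand_def)
    then show "p Q j x \<in> cand Q j x" unfolding p_def by (rule arg_min_natI)
    show "m \<in> cand Q j x \<Longrightarrow> col (p Q j x) \<le> col m" for m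
      unfolding p_def by (rule arg_min_nat_le)
  qed
  have cand_nbhd: "m \<in> nbhd S (rad Q j m) x" "m \<in> nbhd S e x" "m \<in> topspace X"
    if "m \<in> cand Q j x" "x \<in> topspace X" for Q j x m
  proof -
    show m: "m \<in> topspace X" using that M(1) by (auto simp: cand_def)
    show "m \<in> nbhd S (rad Q j m) x" using that nbhd_sym[OF S m] by (auto simp: cand_def)
    then show "m \<in> nbhd S e x" using nbhd_mono[OF S rad_le(2)] by blast
  qed
  have cand_act: "\<phi> g x \<in> cand Q j x \<longleftrightarrow> \<phi> g x \<in> M \<and> g \<in> set_pow G S (rad Q j (\<phi> g x))"
    if "g \<in> carrier G" "x \<in> topspace X" for Q j x g
    using nbhd_act_iff[OF S that] by (auto simp: cand_def)
  show ?thesis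
  proof (rule exI[of _ e], rule exI[of _ E], rule exI[of _ op], intro conjI allI impI ballI)
    fix Q :: "nat \<Rightarrow> 'a \<Rightarrow> 'a" and j
    assume "\<forall>j. \<exists>B. tame B (Q j)"
    then obtain B where B: "\<And>j. tame (B j) (Q j)" by metis
    have lc_rad: "loc_const X (rad Q j)"
      unfolding loc_const_def
    proof
      fix m assume "m \<in> topspace X"
      then have "\<forall>i\<in>{..<j}. \<forall>\<^sub>F y in nhdsin X m. varies S (Q i) E y = varies S (Q i) E m"
        using loc_const_varies[OF S B, of _ E] by (auto simp: loc_const_def)
      then have "\<forall>\<^sub>F y in nhdsin X m. \<forall>i\<in>{..<j}. varies S (Q i) E y = varies S (Q i) E m"
        by (intro eventually_ball_finite) auto
      then show "\<forall>\<^sub>F y in nhdsin X m. rad Q j y = rad Q j m"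
      proof eventually_elim
        case (elim y)
        then have "{i. i < j \<and> varies S (Q i) E y} = {i. i < j \<and> varies S (Q i) E m}" by auto
        then show ?case by (simp add: rad_def rank_def)
      qed
    qed
    have "tame (set_pow G S e) (p Q j)"
      unfolding tame_def
    proof (intro conjI ballI)
      show "finite (set_pow G S e)" "set_pow G S e \<subseteq> carrier G"
        using generatingD[OF S] by (auto intro: finite_set_pow)
      fix x assume x: "x \<in> topspace X"
      obtain g where g: "g \<in> set_pow G S e" "p Q j x = \<phi> g x"
        using cand_nbhd(2)[OF p_cand x] x unfolding nbhd_def by blast
      have gG: "g \<in> carrier G" using g(1) generatingD(5)[OF S] by blast
      \<comment> \<open>Near \<open>x\<close> the candidates and their colours correspond under the
        same group elements. The minimisers for \<open>x\<close> and \<open>y\<close> therefore come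
        from elements \<open>g\<close> and \<open>h\<close> giving equal colours, and the colouring
        forces \<open>h = g\<close>.\<close>
      have "\<forall>\<^sub>F y in nhdsin X x. \<forall>h\<in>set_pow G S e. (\<phi> h y \<in> M) = (\<phi> h x \<in> M) \<and>
        rad Q j (\<phi> h y) = rad Q j (\<phi> h x) \<and> col (\<phi> h y) = col (\<phi> h x)"
      proof (intro eventually_ball_finite ballI eventually_conj)
        fix h assume "h \<in> set_pow G S e"
        then have h: "h \<in> carrier G" using generatingD(5)[OF S] by blast
        show "\<forall>\<^sub>F y in nhdsin X x. (\<phi> h y \<in> M) = (\<phi> h x \<in> M)"
          "\<forall>\<^sub>F y in nhdsin X x. rad Q j (\<phi> h y) = rad Q j (\<phi> h x)"
          "\<forall>\<^sub>F y in nhdsin X x. col (\<phi> h y) = col (\<phi> h x)"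
          using x loc_const_act[OF M(2) h] loc_const_act[OF lc_rad h] loc_const_act[OF col(1) h]
          by (simp_all add: loc_const_def)
      qed (use generatingD[OF S] in \<open>auto intro: finite_set_pow\<close>)
      then have "\<forall>\<^sub>F y in nhdsin X x. p Q j y = \<phi> g y"
        using eventually_in_topspace
      proof eventually_elim
        case (elim y)
        have "\<phi> g y \<in> cand Q j y"
          using elim g gG x p_cand[OF x, of Q j] by (simp add: cand_act)
        then have "col (p Q j y) \<le> col (\<phi> g y)" using p_min elim by blast
        moreover obtain h where h: "h \<in> set_pow G S e" "p Q j y = \<phi> h y"
          using cand_nbhd(2)[OF p_cand] elim unfolding nbhd_def by blast
        have hG: "h \<in> carrier G" using h(1) generatingD(5)[OF S] by blast
        have "\<phi> h x \<in> cand Q j x"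
          using elim h hG x p_cand[of y Q j] by (simp add: cand_act)
        then have "col (\<phi> g x) \<le> col (\<phi> h x)" using p_min[OF x] g by metis
        ultimately have "col (\<phi> g x) = col (\<phi> h x)" using elim h g by simp
        moreover have "\<phi> h x = \<phi> (h \<otimes> inv g) (\<phi> g x)"
          using gG hG x by (simp add: act_mult m_assoc)
        moreover have "h \<otimes> inv g \<in> set_pow G S (2 * e)"
          using set_pow_mult_mem[OF generatingD(1)[OF S] h(1)
              set_pow_inv[OF generatingD(1,4)[OF S] g(1)]] by (simp add: mult_2)
        ultimately have "h \<otimes> inv g = \<one>"
          using col(2)[of "\<phi> g x" "h \<otimes> inv g"] gG x by auto
        then have "h = g" using gG hG by (metis inv_equality inv_inv inv_closed)
        then show ?case using h by simp
      qed
      then show "\<exists>g\<in>set_pow G S e. \<forall>\<^sub>F y in nhdsin X x. p Q j y = \<phi> g y"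
        using g(1) by blast
    qed
    moreover have "op Q j = (\<lambda>x. Q j (p Q j x))" by (simp add: op_def fun_eq_iff)
    ultimately show "\<exists>B. tame B (op Q j)" using tame_comp[OF B] by metis
  next
    fix Q Q' :: "nat \<Rightarrow> 'a \<Rightarrow> 'a" and j
    assume "\<forall>i\<le>j. Q i = Q' i"
    then have Q: "Q i = Q' i" if "i \<le> j" for i using that by blast
    have "{i. i < j \<and> varies S (Q i) E m} = {i. i < j \<and> varies S (Q' i) E m}" for m
      using Q less_imp_le by metis
    then have "rank Q j = rank Q' j" by (simp add: rank_def fun_eq_iff)
    moreover have "Q j = Q' j" using Q by simp
    ultimately show "op Q j = op Q' j"
      by (simp add: op_def p_def cand_def rad_def fun_eq_iff)
  next
    fix Q :: "nat \<Rightarrow> 'a \<Rightarrow> 'a" and j x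
    assume "x \<in> topspace X"
    then show "\<exists>y\<in>nbhd S e x. op Q j x = Q j y"
      using cand_nbhd(2)[OF p_cand] unfolding op_def by blast
  next
    fix Q :: "nat \<Rightarrow> 'a \<Rightarrow> 'a" and N x
    assume H: "\<forall>x\<in>topspace X. card {j. j < N \<and> varies S (Q j) E x} \<le> H"
      and x: "x \<in> topspace X"
    define J where "J = {j. j < N \<and> varies S (op Q j) w x}"
    \<comment> \<open>A cut near \<open>x\<close> means that some cell contains exactly one of
      \<open>x\<close> and a point \<open>y\<close> within \<open>w\<close>, which places
      \<open>x\<close> in an annulus around the marker \<open>m\<close>. Both rounded points lie in
      the \<open>E\<close>-ball of \<open>m\<close> and have different images, so \<open>Q j\<close>
      varies there.\<close>
    have "\<exists>m\<in>M. x \<in> nbhd S (rad Q j m + w) m \<and> x \<notin> nbhd S (rad Q j m - w) m \<and> varies S (Q j) E m"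
      if "j \<in> J" for j
    proof -
      obtain y where y: "y \<in> nbhd S w x" and ne: "Q j (p Q j y) \<noteq> Q j (p Q j x)"
        using \<open>j \<in> J\<close> by (auto simp: J_def varies_def op_def)
      have yX: "y \<in> topspace X" using nbhd_closed[OF S x y] .
      have xy: "x \<in> nbhd S w y" using nbhd_sym[OF S x y] .
      from ne have "cand Q j y \<noteq> cand Q j x" unfolding p_def by metis
      then obtain m where m: "m \<in> M" "(y \<in> nbhd S (rad Q j m) m) \<noteq> (x \<in> nbhd S (rad Q j m) m)"
        unfolding cand_def by blast
      have mX: "m \<in> topspace X" using m M(1) by blast
      have 1: "x \<in> nbhd S (rad Q j m + w) m"
        using m(2) nbhd_trans[OF S mX _ xy] nbhd_mono[OF S, of "rad Q j m" "rad Q j m + w" m]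
        by (metis le_add1 subsetD)
      have 2: "x \<notin> nbhd S (rad Q j m - w) m"
      proof
        assume a: "x \<in> nbhd S (rad Q j m - w) m"
        have "rad Q j m - w + w = rad Q j m" using rad_le(1)[of Q j m] le(2) by simp
        then have "y \<in> nbhd S (rad Q j m) m" using nbhd_trans[OF S mX a y] by simp
        moreover have "x \<in> nbhd S (rad Q j m) m"
          using a nbhd_mono[OF S, of "rad Q j m - w" "rad Q j m" m] by auto
        ultimately show False using m(2) by blast
      qed
      have mx: "x \<in> nbhd S (e + w) m"
        using 1 nbhd_mono[OF S add_right_mono[OF rad_le(2)], of Q j m w m] by blast
      have near: "p Q j y \<in> nbhd S E m" "p Q j x \<in> nbhd S E m"
      proof -
        have "p Q j y \<in> nbhd S (e + w + w + e) m"
          using nbhd_trans[OF S mX nbhd_trans[OF S mX mx y] cand_nbhd(2)[OF p_cand[OF yX] yX]] .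
        moreover have "e + w + w + e = E" by (simp add: E_def)
        ultimately show "p Q j y \<in> nbhd S E m" by (simp only:)
        have "p Q j x \<in> nbhd S (e + w + e) m"
          using nbhd_trans[OF S mX mx cand_nbhd(2)[OF p_cand[OF x] x]] .
        then show "p Q j x \<in> nbhd S E m"
          using nbhd_mono[OF S, of "e + w + e" E m] by (auto simp: E_def)
      qed
      then have "varies S (Q j) E m" using ne unfolding varies_def by metis
      then show ?thesis using m(1) 1 2 by blast
    qed
    then obtain \<mu> where \<mu>: "\<And>j. j \<in> J \<Longrightarrow> \<mu> j \<in> M"
      "\<And>j. j \<in> J \<Longrightarrow> x \<in> nbhd S (rad Q j (\<mu> j) + w) (\<mu> j)"
      "\<And>j. j \<in> J \<Longrightarrow> x \<notin> nbhd S (rad Q j (\<mu> j) - w) (\<mu> j)"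
      "\<And>j. j \<in> J \<Longrightarrow> varies S (Q j) E (\<mu> j)"
      by metis
    \<comment> \<open>If \<open>i < j\<close> shared a marker, \<open>i\<close> would be counted in
      the rank of \<open>j\<close> but not in its own, so the two radii would differ by at least
      \<open>2 * w + 1\<close> and \<open>x\<close> could not lie in both annuli.\<close>
    have ne: "\<mu> i \<noteq> \<mu> j" if ij: "i \<in> J" "j \<in> J" "i < j" for i j
    proof
      assume eq: "\<mu> i = \<mu> j"
      let ?m = "\<mu> j"
      have mX: "?m \<in> topspace X" using \<mu>(1) M(1) ij by blast
      have "rank Q i ?m < rank Q j ?m"
        unfolding rank_def using ij \<mu>(4)[OF ij(1)] eq by (intro psubset_card_mono) auto
      moreover have "rank Q j ?m \<le> H"
      proof -
        have "rank Q j ?m \<le> card {j. j < N \<and> varies S (Q j) E ?m}"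
          unfolding rank_def using ij by (intro card_mono) (auto simp: J_def)
        then show ?thesis using H mX by (meson le_trans)
      qed
      ultimately have "min H (rank Q i ?m) + 1 \<le> min H (rank Q j ?m)" by simp
      then have "(2 * w + 1) * (min H (rank Q i ?m) + 1) \<le> (2 * w + 1) * min H (rank Q j ?m)"
        by (rule mult_le_mono2)
      then have "rad Q i ?m + w \<le> rad Q j ?m - w" by (simp add: rad_def algebra_simps)
      then have "x \<in> nbhd S (rad Q j ?m - w) ?m"
        using \<mu>(2)[OF ij(1)] nbhd_mono[OF S] eq by fastforce
      then show False using \<mu>(3)[OF ij(2)] by blast
    qed
    then have inj: "inj_on \<mu> J" by (intro inj_onI) (metis linorder_neqE_nat)
    \<comment> \<open>Packing: the \<open>q\<close>-balls around these markers are disjoint by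
      \<open>r\<close>-separation and lie in the ball of radius \<open>5 * q\<close>, so doubling
      bounds their number by \<open>K\<close>, whatever \<open>H\<close> was.\<close>
    let ?D = "M \<inter> nbhd S (2 * r) x"
    have "\<mu> ` J \<subseteq> ?D"
    proof
      fix m assume "m \<in> \<mu> ` J"
      then obtain j where j: "j \<in> J" "m = \<mu> j" by blast
      have "rad Q j m + w \<le> 2 * r" using rad_le(2)[of Q j m] le by linarith
      then have "x \<in> nbhd S (2 * r) m" using \<mu>(2)[OF j(1)] j(2) nbhd_mono[OF S] by blast
      then show "m \<in> ?D" using nbhd_sym[OF S] \<mu>(1)[OF j(1)] j(2) M(1) by blast
    qed
    have finD: "finite ?D" using finite_nbhd[OF S] by blast
    have "card J \<le> card ?D"
      using card_inj_on_le[OF inj \<open>\<mu> ` J \<subseteq> ?D\<close> finD] .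
    moreover have "card ?D * card (set_pow G S q) \<le> K * card (set_pow G S q)"
    proof -
      have "nbhd S q m \<inter> nbhd S q m' = {}" if "m \<in> ?D" "m' \<in> ?D" "m \<noteq> m'" for m m'
      proof (rule ccontr)
        have mX: "m \<in> topspace X" "m' \<in> topspace X" using M(1) that by auto
        assume "nbhd S q m \<inter> nbhd S q m' \<noteq> {}"
        then obtain z where z: "z \<in> nbhd S q m" "z \<in> nbhd S q m'" by blast
        have "m' \<in> nbhd S (q + q) m"
          using nbhd_trans[OF S mX(1) z(1) nbhd_sym[OF S mX(2) z(2)]] .
        then show False using M(3)[of m m'] that by (simp add: r_def mult_2)
      qed
      then have "card (\<Union>m\<in>?D. nbhd S q m) = (\<Sum>m\<in>?D. card (nbhd S q m))"
        using finD finite_nbhd[OF S] by (intro card_UN_disjoint) auto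
      also have "\<dots> = card ?D * card (set_pow G S q)"
        using M(1) by (simp add: card_nbhd[OF S] subset_iff)
      finally have "card ?D * card (set_pow G S q) = card (\<Union>m\<in>?D. nbhd S q m)" by simp
      also have "\<dots> \<le> card (nbhd S (5 * q) x)"
      proof (intro card_mono finite_nbhd[OF S] UN_least)
        fix m assume "m \<in> ?D"
        then have "nbhd S q m \<subseteq> nbhd S (2 * r + q) x"
          using nbhd_trans[OF S x] by blast
        also have "2 * r + q = 5 * q" by (simp add: r_def)
        finally show "nbhd S q m \<subseteq> nbhd S (5 * q) x" .
      qed
      also have "\<dots> \<le> K * card (set_pow G S q)" using card_nbhd[OF S x] Kq by simp
      finally show ?thesis .
    qed
    moreover have "card (set_pow G S q) > 0"
      using finite_set_pow[OF generatingD(2)[OF S]] one_in_set_pow[OF generatingD(3)[OF S]]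
      by (auto simp: card_gt_0_iff)
    ultimately have "card J \<le> K" by simp
    then show "card {j. j < N \<and> varies S (op Q j) w x} \<le> K" by (simp add: J_def)
  qed
qed

end

section \<open>Asymptotically invariant sequences of finite relations\<close>

lemma finite_if_card_initial_segments_bounded:
  fixes K :: nat
  assumes "\<And>N. card {j. j < N \<and> R j} \<le> K"
  shows "finite {j::nat. R j}"
proof (rule ccontr)
  assume "infinite {j. R j}"
  then obtain F where F: "finite F" "card F = Suc K" "F \<subseteq> {j. R j}"
    by (meson infinite_arbitrarily_large)
  then obtain N where "\<And>j. j \<in> F \<Longrightarrow> j < N"
    using finite_nat_set_iff_bounded[of F] by auto
  then have "F \<subseteq> {j. j < N \<and> R j}" using F by auto
  then have "card F \<le> card {j. j < N \<and> R j}" by (intro card_mono) auto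
  then show False using assms[of N] F by simp
qed

context free_continuous_action_base
begin

lemma nbhd_subset:
  assumes "generating G T" "S \<subseteq> T" "m \<le> n"
  shows "nbhd S m x \<subseteq> nbhd T n x"
proof -
  have "nbhd S m x \<subseteq> nbhd T m x"
    unfolding nbhd_def using set_pow_mono[OF assms(2)] by (intro image_mono)
  then show ?thesis using nbhd_mono[OF assms(1,3)] by blast
qed

lemma ex_asymptotically_invariant:
  assumes nil: "locally_nilpotent_group G" and count: "countable (carrier G)"
  obtains P :: "nat \<Rightarrow> 'a \<Rightarrow> 'a" and B where "\<And>n. tame (B n) (P n)" "P 0 = (\<lambda>x. x)"
    "\<And>x g. x \<in> topspace X \<Longrightarrow> g \<in> carrier G \<Longrightarrow> \<forall>\<^sub>F n in sequentially. P n (\<phi> g x) = P n x"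
proof -
  define T where "T i = from_nat_into (carrier G) ` {..i}" for i
  define S where "S i = symmetrize G (T i)" for i
  have ran: "range (from_nat_into (carrier G)) = carrier G"
    using count by (intro range_from_nat_into) auto
  then have T: "finite (T i)" "T i \<subseteq> carrier G" for i by (auto simp: T_def)
  have S: "generating G (S i)" for i
    using symmetrize_closed[OF T(2), of i] symmetrize_inv[OF T(2), of _ i] T(1)[of i]
    unfolding generating_def S_def by (intro conjI ballI) (auto simp: symmetrize_def[of G "T i"])
  have S_Suc: "S i \<subseteq> S (Suc i)" for i
    unfolding S_def T_def by (intro symmetrize_mono image_mono) auto
  have S_ex: "\<exists>i. g \<in> S i" if "g \<in> carrier G" for g
  proof -
    obtain i where "g = from_nat_into (carrier G) i" using \<open>g \<in> carrier G\<close> ran by blast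
    then show ?thesis by (auto simp: S_def T_def symmetrize_def)
  qed
  have "\<forall>i. \<exists>K. \<forall>m. \<exists>q\<ge>m. card (set_pow G (S i) (5 * q)) \<le> K * card (set_pow G (S i) q)"
    using locally_nilpotent_doubling[OF nil T] unfolding S_def by blast
  then obtain K where K: "\<And>i m. \<exists>q\<ge>m. card (set_pow G (S i) (5 * q)) \<le> K i * card (set_pow G (S i) q)"
    by metis
  \<comment> \<open>The input bound is \<open>Suc (K (Suc i))\<close>: level \<open>i\<close>
    receives the output of level \<open>Suc i\<close> together with one new map, the identity at
    index 0.\<close>
  define good where "good i w e E op \<longleftrightarrow>
    (\<forall>Q. (\<forall>j. \<exists>B. tame B (Q j)) \<longrightarrow> (\<forall>j. \<exists>B. tame B (op Q j))) \<and>
    (\<forall>Q Q' j. (\<forall>k\<le>j. Q k = Q' k) \<longrightarrow> op Q j = op Q' j) \<and>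
    (\<forall>Q j. \<forall>x\<in>topspace X. \<exists>y\<in>nbhd (S i) e x. op Q j x = Q j y) \<and>
    (\<forall>Q N. (\<forall>x\<in>topspace X. card {j. j < N \<and> varies (S i) (Q j) E x} \<le> Suc (K (Suc i))) \<longrightarrow>
           (\<forall>x\<in>topspace X. card {j. j < N \<and> varies (S i) (op Q j) w x} \<le> K i))"
    for i w e E :: nat and op :: "(nat \<Rightarrow> 'a \<Rightarrow> 'a) \<Rightarrow> nat \<Rightarrow> 'a \<Rightarrow> 'a"
  have "\<exists>e E op. good i w e E op" for i w
    unfolding good_def by (rule ex_rounding[OF S K])
  then obtain e E op where good: "\<And>i w. good i w (e i w) (E i w) (op i w)"
    by metis
  have op_tame: "\<exists>B. tame B (op i w Q j)" if "\<And>j. \<exists>B. tame B (Q j)" for i w Q j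
    using good[of i w] that unfolding good_def by blast
  have op_causal: "op i w Q j = op i w Q' j" if "\<And>k. k \<le> j \<Longrightarrow> Q k = Q' k" for i w Q Q' j
    using good[of i w] that unfolding good_def by blast
  have op_move: "\<exists>y\<in>nbhd (S i) (e i w) x. op i w Q j x = Q j y" if "x \<in> topspace X" for i w Q j x
    using good[of i w] that unfolding good_def by blast
  have op_card: "card {j. j < N \<and> varies (S i) (op i w Q j) w x} \<le> K i"
    if "\<And>x. x \<in> topspace X \<Longrightarrow> card {j. j < N \<and> varies (S i) (Q j) (E i w) x} \<le> Suc (K (Suc i))"
      "x \<in> topspace X" for i w Q N x
    using good[of i w] that unfolding good_def by blast
  \<comment> \<open>Radii are fixed upwards from level 0. \<open>d i\<close> bounds the displacement
    by the levels below \<open>i\<close>; the next \<open>w\<close> dominates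
    \<open>E i (w i)\<close> and exceeds the next \<open>d\<close>. No circle arises, since the
    input bound of level \<open>i\<close> involves only \<open>K (Suc i)\<close>.\<close>
  define st where "st = rec_nat (1, 0) (\<lambda>i (w, d). (max (E i w) (Suc (d + e i w)), d + e i w))"
  define w d where "w i = fst (st i)" and "d i = snd (st i)" for i
  have st: "w 0 = 1" "d 0 = 0" "E i (w i) \<le> w (Suc i)" "d (Suc i) = d i + e i (w i)" for i
    by (simp_all add: w_def d_def st_def split: prod.splits)
  have wd: "Suc (d i) \<le> w i" for i
    by (cases i) (simp_all add: w_def d_def st_def split: prod.splits)
  \<comment> \<open>\<open>Lv n i\<close> applies the roundings at levels \<open>i + n - 1\<close>
    down to \<open>i\<close>. At each level the sequence is shifted by one with the identity in
    front, so entry \<open>k\<close> enters at level \<open>i + k\<close> once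
    \<open>k < n\<close>.\<close>
  define Lv where "Lv = rec_nat (\<lambda>i k x. x) (\<lambda>n L i. op i (w i) (case_nat (\<lambda>x. x) (L (Suc i))))"
  have Lv0: "Lv 0 i k = (\<lambda>x. x)"
    and LvS: "Lv (Suc n) i = op i (w i) (case_nat (\<lambda>x. x) (Lv n (Suc i)))" for n i k
    by (simp_all add: Lv_def)
  have Lv_tame: "\<exists>B. tame B (Lv n i k)" for n i k
  proof (induction n arbitrary: i k)
    case 0
    then show ?case using tame_id by (auto simp: Lv0)
  next
    case (Suc n)
    show ?case
      unfolding LvS
    proof (rule op_tame)
      show "\<exists>B. tame B (case j of 0 \<Rightarrow> \<lambda>x. x | Suc k \<Rightarrow> Lv n (Suc i) k)" for j
        using tame_id Suc by (cases j) auto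
    qed
  qed
  \<comment> \<open>By causality an entry \<open>k\<close> sees only levels \<open>i\<close> to
    \<open>i + k\<close>, all of which are present in both sequences.\<close>
  have Lv_stable: "Lv n i k = Lv n' i k" if "k < n" "k < n'" for n n' i k
    using that
  proof (induction n arbitrary: n' i k)
    case (Suc n)
    then obtain n'' where n': "n' = Suc n''" by (cases n') auto
    show ?case
      unfolding n' LvS using Suc by (intro op_causal) (auto simp: n' split: nat.split)
  qed simp
  have Lv_card: "card {k. k < n \<and> varies (S i) (Lv n i k) (w i) x} \<le> K i" if "x \<in> topspace X" for n i x
    using that
  proof (induction n arbitrary: i x)
    case (Suc n)
    show ?case
      unfolding LvS
    proof (rule op_card)
      fix x assume x: "x \<in> topspace X"
      let ?A = "{k. k < n \<and> varies (S (Suc i)) (Lv n (Suc i) k) (w (Suc i)) x}"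
      have "varies (S (Suc i)) P (w (Suc i)) x" if "varies (S i) P (E i (w i)) x" for P
        using that nbhd_subset[OF S S_Suc st(3)] unfolding varies_def by blast
      then have "j \<in> insert 0 (Suc ` ?A)"
        if "j < Suc n" "varies (S i) (case j of 0 \<Rightarrow> \<lambda>x. x | Suc k \<Rightarrow> Lv n (Suc i) k) (E i (w i)) x" for j
        using that by (cases j) auto
      then have "{j. j < Suc n \<and> varies (S i) (case j of 0 \<Rightarrow> \<lambda>x. x | Suc k \<Rightarrow> Lv n (Suc i) k) (E i (w i)) x}
        \<subseteq> insert 0 (Suc ` ?A)"
        by blast
      then have "card {j. j < Suc n \<and> varies (S i) (case j of 0 \<Rightarrow> \<lambda>x. x | Suc k \<Rightarrow> Lv n (Suc i) k) (E i (w i)) x}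
        \<le> card (insert 0 (Suc ` ?A))"
        by (intro card_mono) auto
      also have "\<dots> \<le> Suc (card ?A)"
        by (simp add: card_insert_if card_image)
      also have "\<dots> \<le> Suc (K (Suc i))" using Suc.IH[OF x] by simp
      finally show "card {j. j < Suc n \<and> varies (S i) (case j of 0 \<Rightarrow> \<lambda>x. x | Suc k \<Rightarrow> Lv n (Suc i) k) (E i (w i)) x}
        \<le> Suc (K (Suc i))" .
    qed (rule Suc.prems)
  qed simp
  \<comment> \<open>Unrolling the lowest \<open>i\<close> levels replaces the argument by a point
    whose distance is the sum of the displacements of these levels.\<close>
  have Lv_move: "\<exists>y\<in>nbhd (S i) (d i) x. Lv (i + n) 0 (i + k) x = Lv n i k y"
    if x: "x \<in> topspace X" for i n k x
  proof (induction i arbitrary: n k)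
    case 0
    then show ?case using nbhd_refl[OF S x] by auto
  next
    case (Suc i)
    obtain y where y: "y \<in> nbhd (S i) (d i) x" "Lv (i + Suc n) 0 (i + Suc k) x = Lv (Suc n) i (Suc k) y"
      using Suc by blast
    have "y \<in> topspace X" using nbhd_closed[OF S x y(1)] .
    then obtain z where z: "z \<in> nbhd (S i) (e i (w i)) y" "Lv (Suc n) i (Suc k) y = Lv n (Suc i) k z"
      using op_move[of y i "w i" "case_nat (\<lambda>x. x) (Lv n (Suc i))" "Suc k"] by (auto simp: LvS)
    have "z \<in> nbhd (S i) (d (Suc i)) x" using nbhd_trans[OF S x y(1) z(1)] by (simp add: st)
    then have "z \<in> nbhd (S (Suc i)) (d (Suc i)) x" using nbhd_subset[OF S S_Suc] by blast
    then show ?case using y z by auto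
  qed
  define P where "P n = Lv (Suc n) 0 n" for n
  have inv: "\<forall>\<^sub>F n in sequentially. P n (\<phi> g x) = P n x" if x: "x \<in> topspace X" and g: "g \<in> carrier G" for x g
  proof -
    obtain i where i: "g \<in> S i" using S_ex[OF g] by blast
    have gx: "\<phi> g x \<in> nbhd (S i) 1 x"
      unfolding nbhd_def using i set_pow_1[OF generatingD(1)[OF S]] by blast
    \<comment> \<open>For \<open>g\<close> in \<open>S i\<close> both values are values of one
      level-\<open>i\<close> map at points within \<open>1 + d i \<le> w i\<close> of
      \<open>x\<close>; a disagreement is thus a variation counted by
      \<open>Lv_card\<close>.\<close>
    have sub: "{j. j < N \<and> P (i + j) (\<phi> g x) \<noteq> P (i + j) x} \<subseteq> {k. k < N \<and> varies (S i) (Lv N i k) (w i) x}" for N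
    proof safe
      fix j assume j: "j < N" and ne: "P (i + j) (\<phi> g x) \<noteq> P (i + j) x"
      have eq: "P (i + j) = Lv (i + N) 0 (i + j)" unfolding P_def using j by (intro Lv_stable) auto
      obtain y where y: "y \<in> nbhd (S i) (d i) x" "P (i + j) x = Lv N i j y"
        using Lv_move[OF x] eq by metis
      obtain z where z: "z \<in> nbhd (S i) (d i) (\<phi> g x)" "P (i + j) (\<phi> g x) = Lv N i j z"
        using Lv_move[OF act_closed[OF g x]] eq by metis
      have "z \<in> nbhd (S i) (1 + d i) x" using nbhd_trans[OF S x gx z(1)] .
      then have "z \<in> nbhd (S i) (w i) x" "y \<in> nbhd (S i) (w i) x"
        using nbhd_mono[OF S, of "1 + d i" "w i" i x] nbhd_mono[OF S, of "d i" "w i" i x] wd[of i] y(1) by auto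
      then show "varies (S i) (Lv N i j) (w i) x" using ne y z unfolding varies_def by metis
    qed
    have "card {j. j < N \<and> P (i + j) (\<phi> g x) \<noteq> P (i + j) x} \<le> K i" for N
      by (rule le_trans[OF card_mono[OF _ sub] Lv_card[OF x]]) simp
    then have "finite {j. P (i + j) (\<phi> g x) \<noteq> P (i + j) x}"
      by (rule finite_if_card_initial_segments_bounded)
    then have "\<forall>\<^sub>F j in sequentially. P (j + i) (\<phi> g x) = P (j + i) x"
      by (simp add: eventually_cofinite flip: cofinite_eq_sequentially add.commute[of i])
    then show ?thesis by (rule eventually_sequentially_seg[THEN iffD1])
  qed
  \<comment> \<open>Putting the identity in front lets the code determine the point itself, which
    yields injectivity.\<close>
  define P' where "P' = case_nat (\<lambda>x. x) P"
  have "\<exists>B. tame B (P' n)" for n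
    unfolding P'_def using tame_id Lv_tame by (auto simp: P_def split: nat.split)
  then obtain B where B: "\<And>n. tame (B n) (P' n)" by metis
  show thesis
  proof (rule that)
    show "tame (B n) (P' n)" for n by (rule B)
    show "P' 0 = (\<lambda>x. x)" by (simp add: P'_def)
    fix x g assume "x \<in> topspace X" "g \<in> carrier G"
    then have "\<forall>\<^sub>F n in sequentially. P' (Suc n) (\<phi> g x) = P' (Suc n) x"
      using inv by (simp add: P'_def)
    then show "\<forall>\<^sub>F n in sequentially. P' n (\<phi> g x) = P' n x"
      by (rule eventually_sequentially_Suc[THEN iffD1])
  qed
qed

end

section \<open>Coding into \<open>E0\<close>\<close>

lemma loc_const_imp_continuous_map:
  assumes "loc_const X f"
  shows "continuous_map X (discrete_topology UNIV) f"
proof -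
  have "openin X {x \<in> topspace X. f x \<in> U}" for U
  proof (subst openin_subopen, clarify)
    fix x assume x: "x \<in> topspace X" "f x \<in> U"
    then obtain V where "openin X V" "x \<in> V" "\<forall>y\<in>V. f y = f x"
      using assms unfolding loc_const_def eventually_nhdsin by blast
    then show "\<exists>V. openin X V \<and> x \<in> V \<and> V \<subseteq> {x \<in> topspace X. f x \<in> U}"
      using x openin_subset by (intro exI[of _ V]) fastforce
  qed
  then show ?thesis by (simp add: continuous_map_def)
qed

text \<open>The bits form the indicator function of the graph of \<open>n \<mapsto> a n x\<close>
  under the pairing. Changing one value alters only two bits, and since
  \<open>prod_encode (n, c) \<ge> n\<close>, agreement of all late bits gives agreement of all late
  values.\<close>

lemma ex_E0_coding:
  fixes a :: "nat \<Rightarrow> 'a \<Rightarrow> nat"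
  assumes "\<And>n. loc_const X (a n)"
  obtains f where "continuous_map X cantor_space f"
    "\<And>x y. f x = f y \<longleftrightarrow> (\<forall>n. a n x = a n y)"
    "\<And>x y. E0 (f x) (f y) \<longleftrightarrow> (\<exists>N. \<forall>n\<ge>N. a n x = a n y)"
proof -
  define f where "f x i = (a (fst (prod_decode i)) x = snd (prod_decode i))" for x i
  have f_enc: "f x (prod_encode (n, c)) \<longleftrightarrow> a n x = c" for x n c
    by (simp add: f_def)
  show thesis
  proof (rule that)
    have "loc_const X (\<lambda>x. f x i)" for i
      unfolding loc_const_def
    proof
      fix x assume "x \<in> topspace X"
      then have "\<forall>\<^sub>F y in nhdsin X x. a (fst (prod_decode i)) y = a (fst (prod_decode i)) x"
        using assms by (auto simp: loc_const_def)
      then show "\<forall>\<^sub>F y in nhdsin X x. f y i = f x i"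
        by eventually_elim (simp add: f_def)
    qed
    then show "continuous_map X cantor_space f"
      unfolding cantor_space_def continuous_map_componentwise_UNIV
      by (blast intro: loc_const_imp_continuous_map)
  next
    fix x y
    show "f x = f y \<longleftrightarrow> (\<forall>n. a n x = a n y)"
    proof
      assume "f x = f y"
      then have "f y (prod_encode (n, a n x))" for n using f_enc[of x n "a n x"] by simp
      then show "\<forall>n. a n x = a n y" using f_enc by simp
    qed (simp add: f_def fun_eq_iff)
    show "E0 (f x) (f y) \<longleftrightarrow> (\<exists>N. \<forall>n\<ge>N. a n x = a n y)"
    proof
      assume "E0 (f x) (f y)"
      then obtain m where m: "\<And>i. i \<ge> m \<Longrightarrow> f x i = f y i" by (auto simp: E0_def)
      have "a n x = a n y" if "n \<ge> m" for n
        using m[of "prod_encode (n, a n x)"] that le_prod_encode_1[of n "a n x"] f_enc by auto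
      then show "\<exists>N. \<forall>n\<ge>N. a n x = a n y" by blast
    next
      assume "\<exists>N. \<forall>n\<ge>N. a n x = a n y"
      then obtain N where N: "\<And>n. n \<ge> N \<Longrightarrow> a n x = a n y" by blast
      let ?D = "prod_encode ` ((\<lambda>n. (n, a n x)) ` {..<N} \<union> (\<lambda>n. (n, a n y)) ` {..<N})"
      have "finite ?D" by blast
      then obtain m where m: "\<And>i. i \<in> ?D \<Longrightarrow> i < m"
        using finite_nat_set_iff_bounded[of ?D] by blast
      have "f x i = f y i" if "i \<ge> m" for i
      proof (rule ccontr)
        assume ne: "f x i \<noteq> f y i"
        obtain n c where i: "i = prod_encode (n, c)" by (metis prod_decode_inverse surj_pair)
        then have ac: "(a n x = c) \<noteq> (a n y = c)" using ne f_enc by simp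
        then have "n < N" using N[of n] by (metis not_le)
        then have "i \<in> ?D" using ac i by blast
        then show False using m[of i] that by simp
      qed
      then show "E0 (f x) (f y)" by (auto simp: E0_def)
    qed
  qed
qed

context free_continuous_action_base
begin

text \<open>The steps \<open>t n x\<close> show that two points with the same late codes move in
  parallel, while the pictures \<open>pic n x\<close> locate ever more translates in ever more basic
  sets and so force the moving points to coincide.\<close>

lemma ex_embedding:
  assumes count: "countable (carrier G)"
    and tameP: "\<And>n. tame (B n) (P n)" and P0: "P 0 = (\<lambda>x. x)"
    and P_inv: "\<And>x g. x \<in> topspace X \<Longrightarrow> g \<in> carrier G \<Longrightarrow> \<forall>\<^sub>F n in sequentially. P n (\<phi> g x) = P n x"
  shows "\<exists>f. continuous_map X cantor_space f \<and> inj_on f (topspace X) \<and>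
           (\<forall>x\<in>topspace X. \<forall>y\<in>topspace X. (\<exists>g\<in>carrier G. \<phi> g x = y) \<longleftrightarrow> E0 (f x) (f y))"
proof -
  have B: "finite (B n)" "B n \<subseteq> carrier G" for n using tameP[of n] by (auto simp: tame_def)
  have PX: "P n x \<in> topspace X" if "x \<in> topspace X" for n x using tame_closed[OF tameP that] .
  define t where "t n x = (THE g. g \<in> carrier G \<and> P (Suc n) x = \<phi> g (P n x))" for n x
  have t_eq: "t n x = g' \<otimes> inv g"
    if "x \<in> topspace X" "g \<in> carrier G" "g' \<in> carrier G" "P n x = \<phi> g x" "P (Suc n) x = \<phi> g' x" for n x g g'
    unfolding t_def
  proof (rule the_equality)
    show *: "g' \<otimes> inv g \<in> carrier G \<and> P (Suc n) x = \<phi> (g' \<otimes> inv g) (P n x)"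
      using that by (simp add: act_mult m_assoc)
    show "h = g' \<otimes> inv g" if "h \<in> carrier G \<and> P (Suc n) x = \<phi> h (P n x)" for h
      using * that PX[OF \<open>x \<in> topspace X\<close>] by (metis act_eq_iff)
  qed
  have t: "t n x \<in> carrier G" "P (Suc n) x = \<phi> (t n x) (P n x)" if x: "x \<in> topspace X" for n x
  proof -
    obtain g where g: "g \<in> carrier G" "P n x = \<phi> g x" by (rule tameE[OF tameP x])
    obtain g' where g': "g' \<in> carrier G" "P (Suc n) x = \<phi> g' x" by (rule tameE[OF tameP x])
    note eq = t_eq[OF x g(1) g'(1) g(2) g'(2)]
    show "t n x \<in> carrier G" "P (Suc n) x = \<phi> (t n x) (P n x)"
      unfolding eq using g g' x by (simp_all add: act_mult m_assoc)
  qed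
  \<comment> \<open>This finite set contains every element carrying \<open>P n x\<close> back to
    some earlier \<open>P m x\<close>.\<close>
  define C where "C n = (\<Union>m\<le>n. B m <#> m_inv G ` B n)" for n
  have C: "finite (C n)" "C n \<subseteq> carrier G" for n
    using B unfolding C_def by (fastforce simp: set_mult_def)+
  define pic where "pic n x = {(g, k) \<in> C n \<times> {..<n}. \<phi> g (P n x) \<in> W k}" for n x
  define V where "V n = carrier G \<times> Pow (C n \<times> {..<n})" for n
  have V: "countable (V n)" for n
    unfolding V_def by (rule countable_SIGMA[OF count countable_finite]) (use C in auto)
  \<comment> \<open>Countability of \<open>G\<close> makes the numbering of \<open>V n\<close>
    injective.\<close>
  define a where "a n x = to_nat_on (V n) (t n x, pic n x)" for n x
  have a_iff: "a n x = a n y \<longleftrightarrow> t n x = t n y \<and> pic n x = pic n y"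
    if "x \<in> topspace X" "y \<in> topspace X" for n x y
  proof -
    have "(t n x, pic n x) \<in> V n" "(t n y, pic n y) \<in> V n"
      using t that by (auto simp: V_def pic_def)
    then show ?thesis unfolding a_def using to_nat_on_inj[OF V] by auto
  qed
  have "loc_const X (a n)" for n
    unfolding loc_const_def
  proof
    fix x assume x: "x \<in> topspace X"
    obtain g where g: "g \<in> carrier G" "P n x = \<phi> g x" "\<forall>\<^sub>F y in nhdsin X x. P n y = \<phi> g y"
      by (rule tameE[OF tameP x])
    obtain g' where g': "g' \<in> carrier G" "P (Suc n) x = \<phi> g' x" "\<forall>\<^sub>F y in nhdsin X x. P (Suc n) y = \<phi> g' y"
      by (rule tameE[OF tameP x])
    have "\<forall>\<^sub>F y in nhdsin X x. \<forall>p\<in>C n \<times> {..<n}. (\<phi> (fst p) (P n y) \<in> W (snd p)) = (\<phi> (fst p) (P n x) \<in> W (snd p))"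
    proof (intro eventually_ball_finite ballI)
      fix p assume "p \<in> C n \<times> {..<n}"
      then have "fst p \<in> carrier G" using C(2)[of n] by auto
      moreover have "loc_const X (\<lambda>z. z \<in> W k)" for k
        using W_clopen by (auto simp: loc_const_def intro: eventually_nhdsin_clopen)
      ultimately have "loc_const X (\<lambda>x. \<phi> (fst p) (P n x) \<in> W (snd p))"
        by (intro loc_const_tame[OF tameP] loc_const_act)
      then show "\<forall>\<^sub>F y in nhdsin X x. (\<phi> (fst p) (P n y) \<in> W (snd p)) = (\<phi> (fst p) (P n x) \<in> W (snd p))"
        using x by (simp add: loc_const_def)
    qed (use C in auto)
    then show "\<forall>\<^sub>F y in nhdsin X x. a n y = a n x"
      using g(3) g'(3) eventually_in_topspace
    proof eventually_elim
      case (elim y)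
      have "t n y = t n x"
        using t_eq[OF x g(1) g'(1) g(2) g'(2)] t_eq[OF _ g(1) g'(1)] elim by simp
      moreover have "pic n y = pic n x" using elim unfolding pic_def by force
      ultimately show ?case by (simp add: a_def)
    qed
  qed
  then obtain f where f: "continuous_map X cantor_space f"
    "\<And>x y. f x = f y \<longleftrightarrow> (\<forall>n. a n x = a n y)"
    "\<And>x y. E0 (f x) (f y) \<longleftrightarrow> (\<exists>N. \<forall>n\<ge>N. a n x = a n y)"
    using ex_E0_coding by blast
  have P_eq: "P N x = P N y"
    if x: "x \<in> topspace X" and y: "y \<in> topspace X" and N: "\<And>n. n \<ge> N \<Longrightarrow> a n x = a n y" for x y N
  proof (rule ccontr)
    assume ne: "P N x \<noteq> P N y"
    have "openin X (topspace X - {P N y})"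
      using closedin_Hausdorff_sing_eq[OF Hausdorff] PX[OF y] by auto
    then obtain k where k: "P N x \<in> W k" "P N y \<notin> W k"
      using W_base[of "topspace X - {P N y}" "P N x"] ne PX[OF x] by blast
    \<comment> \<open>Equal steps from \<open>N\<close> on carry both points from stage
      \<open>N\<close> to stage \<open>n\<close> by one and the same element
      \<open>h\<close>.\<close>
    have common: "\<exists>h\<in>carrier G. P n x = \<phi> h (P N x) \<and> P n y = \<phi> h (P N y)" if "N \<le> n" for n
      using that
    proof (induction rule: dec_induct)
      case base
      then show ?case using PX x y by (intro bexI[of _ \<one>]) auto
    next
      case (step n)
      then obtain h where h: "h \<in> carrier G" "P n x = \<phi> h (P N x)" "P n y = \<phi> h (P N y)" by blast
      have "t n x = t n y" using N[of n] step a_iff[OF x y] by simp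
      then have "P (Suc n) x = \<phi> (t n x \<otimes> h) (P N x)" "P (Suc n) y = \<phi> (t n x \<otimes> h) (P N y)"
        using t[OF x, of n] t[OF y, of n] h PX x y by (simp_all add: act_mult)
      then show ?case using t(1)[OF x] h(1) by blast
    qed
    \<comment> \<open>The stage must be at least \<open>N\<close> for the codes to agree and larger
      than \<open>k\<close> for \<open>W k\<close> to appear in the picture.\<close>
    define n where "n = max N (Suc k)"
    obtain h where h: "h \<in> carrier G" "P n x = \<phi> h (P N x)" "P n y = \<phi> h (P N y)"
      using common[of n] by (auto simp: n_def)
    have return: "P N x = \<phi> (inv h) (P n x)" "P N y = \<phi> (inv h) (P n y)"
      using h PX x y by (simp_all add: act_mult)
    obtain b where b: "b \<in> B N" "b \<in> carrier G" "P N x = \<phi> b x" by (rule tameE[OF tameP x])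
    obtain b' where b': "b' \<in> B n" "b' \<in> carrier G" "P n x = \<phi> b' x" by (rule tameE[OF tameP x])
    have "\<phi> (b \<otimes> inv b') (P n x) = P N x"
      using b b' x by (simp add: act_mult m_assoc)
    then have "inv h = b \<otimes> inv b'"
      using return(1) act_eq_iff[OF _ _ PX[OF x]] b(2) b'(2) h(1) by (metis inv_closed m_closed)
    moreover have "b \<otimes> inv b' \<in> C n"
      unfolding C_def using b b' by (auto simp: n_def intro!: bexI[of _ N] set_mult_memI)
    ultimately have "(inv h, k) \<in> pic n x"
      using k return by (simp add: pic_def n_def)
    moreover have "pic n x = pic n y" using N[of n] a_iff[OF x y] by (simp add: n_def)
    ultimately have "(inv h, k) \<in> pic n y" by simp
    then have "P N y \<in> W k" using return by (simp add: pic_def)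
    then show False using k by blast
  qed
  \<comment> \<open>At \<open>N = 0\<close> the conclusion of \<open>P_eq\<close> is equality of the
    points, because \<open>P 0\<close> is the identity.\<close>
  have "inj_on f (topspace X)"
    using P_eq[of _ _ 0] f(2) P0 by (auto intro!: inj_onI)
  moreover have "(\<exists>g\<in>carrier G. \<phi> g x = y) \<longleftrightarrow> E0 (f x) (f y)"
    if x: "x \<in> topspace X" and y: "y \<in> topspace X" for x y
  proof
    assume "\<exists>g\<in>carrier G. \<phi> g x = y"
    then obtain N where N: "\<And>n. n \<ge> N \<Longrightarrow> P n y = P n x"
      using P_inv[OF x] unfolding eventually_sequentially by blast
    \<comment> \<open>The code \<open>a n\<close> depends on the point only through
      \<open>P n\<close> and \<open>P (Suc n)\<close>.\<close>
    then have "a n x = a n y" if "n \<ge> N" for n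
      using that by (simp add: a_def t_def pic_def)
    then show "E0 (f x) (f y)" using f(3) by blast
  next
    assume "E0 (f x) (f y)"
    then obtain N where "P N x = P N y" using f(3) P_eq[OF x y] by blast
    moreover obtain g where g: "g \<in> carrier G" "P N x = \<phi> g x" by (rule tameE[OF tameP x])
    moreover obtain h where h: "h \<in> carrier G" "P N y = \<phi> h y" by (rule tameE[OF tameP y])
    ultimately have "\<phi> (inv h \<otimes> g) x = y"
      using x y by (simp add: act_mult[symmetric]) (simp add: act_mult)
    then show "\<exists>g\<in>carrier G. \<phi> g x = y" using g h by blast
  qed
  ultimately show ?thesis using f(1) by blast
qed

end

theorem theorem9p1:
  fixes G :: "('g, 'c) monoid_scheme" and X :: "'a topology" and \<phi> :: "'g \<Rightarrow> 'a \<Rightarrow> 'a"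
  assumes "locally_nilpotent_group G"
    and "countable (carrier G)"
    and "Polish_space X"
    and "zero_dimensional X"
    and "group_action G (topspace X) \<phi>"
    and "\<And>g. g \<in> carrier G \<Longrightarrow> continuous_map X X (\<phi> g)"
    and "\<And>g x. \<lbrakk>g \<in> carrier G; x \<in> topspace X; \<phi> g x = x\<rbrakk> \<Longrightarrow> g = \<one>\<^bsub>G\<^esub>"
  shows "\<exists>f. continuous_map X cantor_space f \<and> inj_on f (topspace X) \<and>
           (\<forall>x\<in>topspace X. \<forall>y\<in>topspace X.
              (\<exists>g\<in>carrier G. \<phi> g x = y) \<longleftrightarrow> E0 (f x) (f y))"
proof -
  obtain W :: "nat \<Rightarrow> 'a set" where W: "\<And>k. openin X (W k)" "\<And>k. closedin X (W k)"
    "\<And>U x. openin X U \<Longrightarrow> x \<in> U \<Longrightarrow> \<exists>k. x \<in> W k \<and> W k \<subseteq> U"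
    using Polish_zero_dimensional_clopen_base[OF assms(3,4)] by metis
  have "Hausdorff_space X"
    using assms(3) by (simp add: Polish_space_def completely_metrizable_imp_metrizable_space
        metrizable_imp_Hausdorff_space)
  have "group G" using assms(1) by (simp add: locally_nilpotent_group_def)
  then have "free_continuous_action G X \<phi>"
    by (intro free_continuous_action.intro free_continuous_action_axioms.intro assms(5-7))
  then interpret free_continuous_action_base G X \<phi> W
    by (rule free_continuous_action_base.intro[OF _
          free_continuous_action_base_axioms.intro[OF W \<open>Hausdorff_space X\<close>]])
  obtain P :: "nat \<Rightarrow> 'a \<Rightarrow> 'a" and B where "\<And>n. tame (B n) (P n)" "P 0 = (\<lambda>x. x)"
    "\<And>x g. x \<in> topspace X \<Longrightarrow> g \<in> carrier G \<Longrightarrow> \<forall>\<^sub>F n in sequentially. P n (\<phi> g x) = P n x"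
    by (rule ex_asymptotically_invariant[OF assms(1,2)]) (rule that)
  then show ?thesis by (rule ex_embedding[OF assms(2)])
qed

end
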